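(* Let $p = (L \stackrel{l}{\leftarrow} K \stackrel{r}{\rightarrow} R)$ be a non-self-overlapping evaluation rule with $\underline{n}$ the root of $L$, let $G$ be a term graph, and let $g: L \rightarrow G$ be a graph morphism (occurrence). Let $G \Rightarrow_{p,g} H$ be the direct derivation (double-pushout) whose context graph $D$ is obtained from $G$ by making the labelling and successor functions undefined on $g(\underline{n})$, and let $tr: N_G \rightarrow N_H$ be its track function. Then for each node $n \in N_G$, $$\mathcal{U}_G[n] \rightarrow_\Phi \mathcal{U}_H[tr(n)]\sigma,$$ where $\Phi$ is the (possibly infinite) parallel redex $\Phi = \{(\mathcal{O}(\pi), \mathcal{U}[p]) \mid \pi \text{ is a path in } G \text{ from } n \text{ to } g(\underline{n})\}$, and $\sigma: \mathrm{var}(H) \rightarrow \mathrm{var}(G)$ is the substitution with $\sigma(x) = y$ if $y \in \mathrm{var}(G)$ and $tr(y) = x$, and $\sigma(x) = \bot$ if there is no $y \in \mathrm{var}(G)$ with $tr(y) = x$.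
   Context: Terms: occurrences are finite strings of positive naturals ($\lambda$ empty, $\le$ prefix order). For a signature $\Sigma$ and variable set $X$, a term is a partial function $t:\omega^*\to\Sigma\cup X$ whose domain $\mathcal{O}(t)$ satisfies: $wi\in\mathcal{O}(t)\Rightarrow w\in\mathcal{O}(t)$ and $t(w)\in\Sigma_n$ with $n\ge i$. $\bot$ is the empty term. $CT_\Sigma(X)$ is the set of such terms, a cpo under $t\le t'$ iff $t$ is less defined than $t'$ as a partial function (lubs of chains exist). $t/w$ is the subterm at $w$ ($t/w(u)=t(wu)$); $t[w\leftarrow s]$ is replacement. A term is total if $t(w)\in\Sigma_n$ implies $wi\in\mathcal{O}(t)$ for $0<i\le n$; rational if it has finitely many distinct subterms. Substitutions $\sigma:X\to CT_\Sigma(Y)$ extend uniquely to continuous maps with $\bot\sigma=\bot$, $f(t_1,\dots,t_n)\sigma=f(t_1\sigma,\dots,t_n\sigma)$. Rewriting: a rule $l\to r$ is a pair of total terms with $var(r)\subseteq var(l)$, $l$ finite, not a variable. A redex of $t$ is $(w,R)$ with $t/w=l\sigma$ for some $\sigma$; then $t\to t[w\leftarrow r\sigma]$. Orthogonal = left-linear and non-overlapping. Residuals $\Delta\backslash\Delta'$ of redex $\Delta=(w,R)$ after reducing $\Delta'=(w',l'\to r')$: $\emptyset$ if equal; $\{\Delta\}$ if $w\not> w'$; $\{(w'w_xu,R)\mid r'/w_x=l'/v_x\}$ if $w=w'v_xu$ with $l'/v_x$ a variable; extended to sets and sequences. A complete development of a finite set $\Phi$ of redexes is a reduction sequence each step reducing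 a residual of $\Phi$ and leaving no residuals; in an orthogonal system all end in the same term, giving the finite parallel reduction $t\to_\Phi t'$. A parallel redex of $t$ is a countable set $\Phi$ of distinct redexes of $t$. For infinite $\Phi$: take any chain $t_0\le t_1\le\dots$ with lub $t$ such that each redex $(w,R)\in\Phi$ is either a redex of $t_i$ or $t_i(w)=\bot$, and the set $\Phi_i$ of redexes of $\Phi$ that are redexes of $t_i$ is finite; with $t_i\to_{\Phi_i}d_i$, the $d_i$ form a chain and $t\to_\Phi d:=\bigcup_i d_i$ (independent of the chain). Term graphs: $G=(N_G,s_G,l_G)$ with $N_G$ finite, $s_G:N_G\to N_G^*$ and $l_G:N_G\to\Sigma$ partial, defined on the same nodes, $|s_G(n)|$ equal to the arity of $l_G(n)$. A morphism $f:G\to H$ is a map on nodes with $l_H(f(n))=l_G(n)$ and $s_H(f(n))=f^*(s_G(n))$ whenever $l_G(n)$ is defined. Nodes where $l_G$ is undefined are variable nodes, $\mathrm{var}(G)$. A path $\langle n_1,j_1,n_2,\dots,j_k,n_{k+1}\rangle$ has $s_G(n_i)|_{j_i}=n_{i+1}$; its occurrence is $\mathcal{O}(\pi)=j_1\cdots j_k$. $L$ is a tree with root $\underline n$ if there is exactly one path from $\underline n$ to each node. Unraveling $\mathcal{U}_G[n]\in CT_\Sigma(\mathrm{var}(G))$: $\mathcal{U}_G[n](w)=n'$ if a path from $n$ with occurrence $w$ ends at $n'\in\mathrm{var}(G)$, $=l_G(n')$ if it ends at labelled $n'$, $\bot$ if no such path. Evaluation rule: a pair of injective morphisms $L\stackrel{l}{\leftarrow}K\stackrel{r}{\rightarrow}R$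 where $L$ is a tree with root $\underline n$ that is not a single unlabelled node, $K$ equals $L$ with labelling and successor undefined at $\underline n$ and $l$ the inclusion, and $r$ restricted to $\mathrm{var}(L)$ is a bijection onto $\mathrm{var}(R)$. Its unraveling $\mathcal{U}[p]$ is the term rule $\mathcal{U}_L[\underline n]\to\mathcal{U}_R[r(\underline n)]\tau$, where $\tau(x)=y$ iff $r(y)=x$. $p$ is non-self-overlapping if $\mathcal{U}[p]$'s left side does not unify with a proper non-variable subterm of itself. A direct derivation $G\Rightarrow_{p,g}H$ is a double-pushout diagram $L\leftarrow K\rightarrow R$ over $G\stackrel{d}{\leftarrow}D\stackrel{b}{\rightarrow}H$ with both squares pushouts in the category of term graphs; here $D$ has the same nodes as $G$ and the track function is $tr(n)=b(n)$. *)

theory Defs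
  imports "HOL-Library.Sublist" "HOL-Library.Countable_Set"
begin

section \<open>Possibly infinite, possibly partial terms\<close>

text \<open>
  A ranked signature is a type \<open>'f\<close> of symbols with an arity function. Terms are partial functions
  from occurrences to symbols (\<open>Inl\<close>) or variables (\<open>Inr\<close>); the empty term is the empty map, and
  the approximation order is \<open>\<subseteq>\<^sub>m\<close>. Occurrences are lists of positive numbers; positivity is
  enforced by the domain condition in \<open>CT\<close>.
\<close>

type_synonym ('f, 'x) pterm = "nat list \<Rightarrow> ('f + 'x) option"

definition term_vars :: "('f, 'x) pterm \<Rightarrow> 'x set" where
  "term_vars t = {x. \<exists>w. t w = Some (Inr x)}"

definition CT :: "('f \<Rightarrow> nat) \<Rightarrow> 'x set \<Rightarrow> ('f, 'x) pterm set" where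
  "CT ar X = {t.
     (\<forall>w i. w @ [i] \<in> dom t \<longrightarrow> w \<in> dom t \<and> (\<exists>f. t w = Some (Inl f) \<and> 0 < i \<and> i \<le> ar f)) \<and>
     term_vars t \<subseteq> X}"

definition bottom_term :: "('f, 'x) pterm" where
  "bottom_term = Map.empty"

definition var_term :: "'x \<Rightarrow> ('f, 'x) pterm" where
  "var_term x = [[] \<mapsto> Inr x]"

definition fun_term :: "'f \<Rightarrow> ('f, 'x) pterm list \<Rightarrow> ('f, 'x) pterm" where
  "fun_term f ts = (\<lambda>w. case w of
       [] \<Rightarrow> Some (Inl f)
     | i # u \<Rightarrow> if 0 < i \<and> i \<le> length ts then (ts ! (i - 1)) u else None)"

definition subterm_at :: "('f, 'x) pterm \<Rightarrow> nat list \<Rightarrow> ('f, 'x) pterm" where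
  "subterm_at t w = (\<lambda>u. t (w @ u))"

definition replace_at :: "('f, 'x) pterm \<Rightarrow> nat list \<Rightarrow> ('f, 'x) pterm \<Rightarrow> ('f, 'x) pterm" where
  "replace_at t w s = (\<lambda>v. if prefix w v then s (drop (length w) v) else t v)"

definition total_term :: "('f \<Rightarrow> nat) \<Rightarrow> ('f, 'x) pterm \<Rightarrow> bool" where
  "total_term ar t \<longleftrightarrow>
     (\<forall>w f i. t w = Some (Inl f) \<and> 0 < i \<and> i \<le> ar f \<longrightarrow> w @ [i] \<in> dom t)"

definition finite_term :: "('f, 'x) pterm \<Rightarrow> bool" where
  "finite_term t \<longleftrightarrow> finite (dom t)"

definition is_var_term :: "('f, 'x) pterm \<Rightarrow> bool" where
  "is_var_term t \<longleftrightarrow> (\<exists>x. t = var_term x)"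

text \<open>A chain is an increasing sequence; \<open>term_lub\<close> is the least upper bound in the order of \<open>CT\<close>.\<close>

definition term_chain :: "('f \<Rightarrow> nat) \<Rightarrow> 'x set \<Rightarrow> (nat \<Rightarrow> ('f, 'x) pterm) \<Rightarrow> bool" where
  "term_chain ar X T \<longleftrightarrow> (\<forall>i. T i \<in> CT ar X \<and> T i \<subseteq>\<^sub>m T (Suc i))"

definition term_lub ::
    "('f \<Rightarrow> nat) \<Rightarrow> 'x set \<Rightarrow> (nat \<Rightarrow> ('f, 'x) pterm) \<Rightarrow> ('f, 'x) pterm \<Rightarrow> bool" where
  "term_lub ar X T t \<longleftrightarrow> t \<in> CT ar X \<and> (\<forall>i. T i \<subseteq>\<^sub>m t) \<and>
     (\<forall>s \<in> CT ar X. (\<forall>i. T i \<subseteq>\<^sub>m s) \<longrightarrow> t \<subseteq>\<^sub>m s)"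

text \<open>
  The continuous extension of a substitution, by recursion on the occurrence. The lemmas below
  show that it satisfies the equations that determine it.
\<close>

fun tsubst :: "('f, 'x) pterm \<Rightarrow> ('x \<Rightarrow> ('f, 'y) pterm) \<Rightarrow> ('f, 'y) pterm" where
  "tsubst t \<sigma> [] = (case t [] of
       None \<Rightarrow> None | Some (Inl f) \<Rightarrow> Some (Inl f) | Some (Inr x) \<Rightarrow> \<sigma> x [])"
| "tsubst t \<sigma> (i # w) = (case t [] of
       None \<Rightarrow> None | Some (Inl f) \<Rightarrow> tsubst (subterm_at t [i]) \<sigma> w | Some (Inr x) \<Rightarrow> \<sigma> x (i # w))"

lemma tsubst_bottom: "tsubst bottom_term \<sigma> = bottom_term"
proof
  fix w show "tsubst bottom_term \<sigma> w = bottom_term w"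
    by (cases w) (simp_all add: bottom_term_def)
qed

lemma tsubst_var: "tsubst (var_term x) \<sigma> = \<sigma> x"
proof
  fix w show "tsubst (var_term x) \<sigma> w = \<sigma> x w"
    by (cases w) (simp_all add: var_term_def)
qed

lemma tsubst_fun: "tsubst (fun_term f ts) \<sigma> = fun_term f (map (\<lambda>t. tsubst t \<sigma>) ts)"
proof
  fix w
  have bot: "tsubst (\<lambda>u. None) \<sigma> v = None" for v
    using fun_cong[OF tsubst_bottom, of \<sigma> v] by (simp add: bottom_term_def)
  show "tsubst (fun_term f ts) \<sigma> w = fun_term f (map (\<lambda>t. tsubst t \<sigma>) ts) w"
  proof (cases w)
    case Nil
    then show ?thesis by (simp add: fun_term_def)
  next
    case (Cons i u)
    show ?thesis
    proof (cases "0 < i \<and> i \<le> length ts")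
      case True
      then have "subterm_at (fun_term f ts) [i] = ts ! (i - 1)"
        by (auto simp: subterm_at_def fun_term_def)
      moreover have "i - Suc 0 < length ts" using True by linarith
      ultimately show ?thesis using True Cons by (simp add: fun_term_def)
    next
      case False
      then have "subterm_at (fun_term f ts) [i] = (\<lambda>u. None)"
        by (auto simp: subterm_at_def fun_term_def)
      with False Cons bot show ?thesis by (auto simp: fun_term_def)
    qed
  qed
qed

lemma tsubst_continuous:
  assumes chain: "\<And>i. T i \<subseteq>\<^sub>m T (Suc i)"
    and union: "\<And>w a. t w = Some a \<longleftrightarrow> (\<exists>i. T i w = Some a)"
  shows "tsubst t \<sigma> w = Some b \<longleftrightarrow> (\<exists>i. tsubst (T i) \<sigma> w = Some b)"
  using assms
proof (induction w arbitrary: t T)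
  case Nil
  show ?case
  proof (cases "t []")
    case None
    then have "T i [] = None" for i using Nil(2) by (metis not_Some_eq)
    with None show ?thesis by simp
  next
    case (Some a)
    then obtain i0 where i0: "T i0 [] = Some a" using Nil(2) by blast
    have none: "T i [] = None \<or> T i [] = Some a" for i
      using Nil(2) Some by (metis not_Some_eq option.inject)
    have "tsubst t \<sigma> [] = tsubst (T i0) \<sigma> []" using Some i0 by simp
    moreover have "tsubst (T i) \<sigma> [] = None \<or> tsubst (T i) \<sigma> [] = tsubst (T i0) \<sigma> []" for i
      using none[of i] i0 by auto
    ultimately show ?thesis by (metis option.distinct(1))
  qed
next
  case (Cons j w)
  have sub: "subterm_at (T i) [j] \<subseteq>\<^sub>m subterm_at (T (Suc i)) [j]" for i
    using Cons.prems(1)[of i] by (auto simp: map_le_def subterm_at_def dom_def)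
  have sub_un: "subterm_at t [j] v = Some a \<longleftrightarrow> (\<exists>i. subterm_at (T i) [j] v = Some a)" for v a
    using Cons.prems(2) by (simp add: subterm_at_def)
  note IH = Cons.IH[OF sub sub_un]
  have mono: "T i \<subseteq>\<^sub>m T k" if "i \<le> k" for i k
    using that
  proof (induction k rule: dec_induct)
    case base show ?case by (simp add: map_le_def)
  next
    case (step n) then show ?case using Cons.prems(1) map_le_trans by blast
  qed
  have up: "t [] = Some a" if "T i [] = Some a" for i a
    using Cons.prems(2) that by blast
  show ?case
  proof (cases "t []")
    case None
    then have "T i [] = None" for i using up by (metis not_Some_eq)
    with None show ?thesis by simp
  next
    case (Some a)
    then obtain i0 where i0: "T i0 [] = Some a" using Cons.prems(2) by blast
    have none: "T i [] = None \<or> T i [] = Some a" for i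
      using up[of i] Some by (cases "T i []") auto
    show ?thesis
    proof (cases a)
      case (Inr x)
      have "tsubst t \<sigma> (j # w) = tsubst (T i0) \<sigma> (j # w)" using Some i0 Inr by simp
      moreover have "tsubst (T i) \<sigma> (j # w) = None \<or>
          tsubst (T i) \<sigma> (j # w) = tsubst (T i0) \<sigma> (j # w)" for i
        using none[of i] i0 Inr by auto
      ultimately show ?thesis by (metis option.distinct(1))
    next
      case (Inl f)
      have "\<exists>i. tsubst (T i) \<sigma> (j # w) = Some b" if "tsubst (subterm_at t [j]) \<sigma> w = Some b"
      proof -
        have sh: "subterm_at (T (i + i0)) [j] \<subseteq>\<^sub>m subterm_at (T (Suc i + i0)) [j]" for i
          using sub[of "i + i0"] by simp
        have sh_un: "subterm_at t [j] v = Some a \<longleftrightarrow> (\<exists>i. subterm_at (T (i + i0)) [j] v = Some a)"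
          for v a
        proof -
          have "T (i + i0) u = Some a" if "T i u = Some a" for i u
            using mono[of i "i + i0"] that by (force simp: map_le_def)
          then show ?thesis unfolding sub_un by (auto simp: subterm_at_def)
        qed
        have "\<exists>i. tsubst (subterm_at (T (i + i0)) [j]) \<sigma> w = Some b"
          using iffD1[OF Cons.IH[of "\<lambda>i. subterm_at (T (i + i0)) [j]", OF sh sh_un] that] .
        then obtain i where i: "tsubst (subterm_at (T (i + i0)) [j]) \<sigma> w = Some b" ..
        have "T (i + i0) [] = Some a"
          using mono[of i0 "i + i0"] i0 by (force simp: map_le_def)
        with i Inl show ?thesis by (intro exI[of _ "i + i0"]) simp
      qed
      moreover have "tsubst (subterm_at t [j]) \<sigma> w = Some b"
        if "tsubst (T i) \<sigma> (j # w) = Some b" for i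
        using that none[of i] Inl IH by (auto split: option.splits)
      ultimately show ?thesis using Some Inl by auto
    qed
  qed
qed

section \<open>Parallel term rewriting\<close>

type_synonym ('f, 'v) trule = "('f, 'v) pterm \<times> ('f, 'v) pterm"

definition term_rule :: "('f \<Rightarrow> nat) \<Rightarrow> ('f, 'v) trule \<Rightarrow> bool" where
  "term_rule ar R \<longleftrightarrow> (case R of (l, r) \<Rightarrow>
     l \<in> CT ar UNIV \<and> r \<in> CT ar UNIV \<and> total_term ar l \<and> total_term ar r \<and>
     term_vars r \<subseteq> term_vars l \<and> finite_term l \<and> \<not> is_var_term l)"

type_synonym ('f, 'v) redex = "nat list \<times> ('f, 'v) trule"

definition is_redex ::
    "('f \<Rightarrow> nat) \<Rightarrow> 'x set \<Rightarrow> ('f, 'x) pterm \<Rightarrow> ('f, 'v) redex \<Rightarrow> bool" where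
  "is_redex ar X t \<Delta> \<longleftrightarrow> (case \<Delta> of (w, (l, r)) \<Rightarrow>
     term_rule ar (l, r) \<and>
     (\<exists>\<sigma>. (\<forall>x. \<sigma> x \<in> CT ar X) \<and> subterm_at t w = tsubst l \<sigma>))"

definition reduce ::
    "('f \<Rightarrow> nat) \<Rightarrow> 'x set \<Rightarrow> ('f, 'x) pterm \<Rightarrow> ('f, 'v) redex \<Rightarrow> ('f, 'x) pterm \<Rightarrow> bool" where
  "reduce ar X t \<Delta> t' \<longleftrightarrow> (case \<Delta> of (w, (l, r)) \<Rightarrow>
     term_rule ar (l, r) \<and>
     (\<exists>\<sigma>. (\<forall>x. \<sigma> x \<in> CT ar X) \<and> subterm_at t w = tsubst l \<sigma> \<and>
          t' = replace_at t w (tsubst r \<sigma>)))"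

text \<open>
  \<open>residual \<Delta> \<Delta>'\<close> is the set of residuals of \<open>\<Delta>\<close> after reducing \<open>\<Delta>'\<close>, for redexes of an orthogonal
  system (so that distinct nested redexes meet only below a variable of the outer rule).
\<close>

definition residual :: "('f, 'v) redex \<Rightarrow> ('f, 'v) redex \<Rightarrow> ('f, 'v) redex set" where
  "residual \<Delta> \<Delta>' = (case (\<Delta>, \<Delta>') of ((w, R), (w', (l', r'))) \<Rightarrow>
     if \<Delta> = \<Delta>' then {}
     else if \<not> strict_prefix w' w then {\<Delta>}
     else {(w' @ wx @ u, R) | wx vx u. w = w' @ vx @ u \<and>
             is_var_term (subterm_at l' vx) \<and> subterm_at r' wx = subterm_at l' vx})"

definition residuals :: "('f, 'v) redex set \<Rightarrow> ('f, 'v) redex \<Rightarrow> ('f, 'v) redex set" where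
  "residuals \<Phi> \<Delta>' = (\<Union>\<Delta>\<in>\<Phi>. residual \<Delta> \<Delta>')"

text \<open>
  \<open>complete_dev ar X \<Phi> t t'\<close>: some finite reduction sequence from \<open>t\<close> to \<open>t'\<close> reduces in each step a
  residual of \<open>\<Phi>\<close> and leaves none. Intermediate residual sets may be infinite, since right-hand
  sides may be infinite terms.
\<close>

inductive complete_dev ::
    "('f \<Rightarrow> nat) \<Rightarrow> 'x set \<Rightarrow> ('f, 'v) redex set \<Rightarrow> ('f, 'x) pterm \<Rightarrow> ('f, 'x) pterm \<Rightarrow> bool"
  for ar X where
  dev_done: "complete_dev ar X {} t t"
| dev_step: "\<Delta> \<in> \<Phi> \<Longrightarrow> reduce ar X t \<Delta> t1 \<Longrightarrow> complete_dev ar X (residuals \<Phi> \<Delta>) t1 t' \<Longrightarrow>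
         complete_dev ar X \<Phi> t t'"

definition parallel_redex ::
    "('f \<Rightarrow> nat) \<Rightarrow> 'x set \<Rightarrow> ('f, 'x) pterm \<Rightarrow> ('f, 'v) redex set \<Rightarrow> bool" where
  "parallel_redex ar X t \<Phi> \<longleftrightarrow> countable \<Phi> \<and> (\<forall>\<Delta>\<in>\<Phi>. is_redex ar X t \<Delta>)"

definition finite_par_red ::
    "('f \<Rightarrow> nat) \<Rightarrow> 'x set \<Rightarrow> ('f, 'x) pterm \<Rightarrow> ('f, 'v) redex set \<Rightarrow> ('f, 'x) pterm \<Rightarrow> bool" where
  "finite_par_red ar X t \<Phi> t' \<longleftrightarrow>
     finite \<Phi> \<and> parallel_redex ar X t \<Phi> \<and> complete_dev ar X \<Phi> t t'"

text \<open>
  Parallel reduction of a possibly infinite parallel redex. For orthogonal rules neither the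
  complete developments nor the approximating chain influence the result.
\<close>

definition par_red ::
    "('f \<Rightarrow> nat) \<Rightarrow> 'x set \<Rightarrow> ('f, 'x) pterm \<Rightarrow> ('f, 'v) redex set \<Rightarrow> ('f, 'x) pterm \<Rightarrow> bool" where
  "par_red ar X t \<Phi> d \<longleftrightarrow> t \<in> CT ar X \<and> parallel_redex ar X t \<Phi> \<and>
     (if finite \<Phi> then finite_par_red ar X t \<Phi> d
      else \<exists>T D. term_chain ar X T \<and> term_lub ar X T t \<and>
        (\<forall>i. \<forall>(w, R)\<in>\<Phi>. is_redex ar X (T i) (w, R) \<or> T i w = None) \<and>
        (\<forall>i. finite_par_red ar X (T i) {\<Delta>\<in>\<Phi>. is_redex ar X (T i) \<Delta>} (D i)) \<and>
        term_chain ar X D \<and> term_lub ar X D d)"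

section \<open>Term graphs\<close>

record ('n, 'f) tgraph =
  nodes :: "'n set"
  gsucc :: "'n \<Rightarrow> 'n list option"
  glab :: "'n \<Rightarrow> 'f option"

definition term_graph :: "('f \<Rightarrow> nat) \<Rightarrow> ('n, 'f) tgraph \<Rightarrow> bool" where
  "term_graph ar G \<longleftrightarrow> finite (nodes G) \<and>
     dom (gsucc G) = dom (glab G) \<and> dom (glab G) \<subseteq> nodes G \<and>
     (\<forall>n ss f. gsucc G n = Some ss \<and> glab G n = Some f \<longrightarrow>
        set ss \<subseteq> nodes G \<and> length ss = ar f)"

definition var_nodes :: "('n, 'f) tgraph \<Rightarrow> 'n set" where
  "var_nodes G = {n \<in> nodes G. glab G n = None}"

text \<open>Morphisms are functions on the node types, of which only the values on nodes matter.\<close>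

definition graph_morphism :: "('n, 'f) tgraph \<Rightarrow> ('m, 'f) tgraph \<Rightarrow> ('n \<Rightarrow> 'm) \<Rightarrow> bool" where
  "graph_morphism G H f \<longleftrightarrow> f ` nodes G \<subseteq> nodes H \<and>
     (\<forall>n\<in>nodes G. glab G n \<noteq> None \<longrightarrow>
        glab H (f n) = glab G n \<and> gsucc H (f n) = map_option (map f) (gsucc G n))"

text \<open>
  A path is given by its start node and the list of the traversed pairs (successor index, next node);
  its occurrence is the list of indices, which count from 1.
\<close>

fun is_path :: "('n, 'f) tgraph \<Rightarrow> 'n \<Rightarrow> (nat \<times> 'n) list \<Rightarrow> 'n \<Rightarrow> bool" where
  "is_path G n [] m \<longleftrightarrow> n \<in> nodes G \<and> m = n"
| "is_path G n ((j, n') # \<pi>) m \<longleftrightarrow>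
     n \<in> nodes G \<and>
     (\<exists>ss. gsucc G n = Some ss \<and> 0 < j \<and> j \<le> length ss \<and> ss ! (j - 1) = n') \<and> is_path G n' \<pi> m"

definition path_occ :: "(nat \<times> 'n) list \<Rightarrow> nat list" where
  "path_occ \<pi> = map fst \<pi>"

definition is_tree :: "('n, 'f) tgraph \<Rightarrow> 'n \<Rightarrow> bool" where
  "is_tree G n \<longleftrightarrow> n \<in> nodes G \<and> (\<forall>m\<in>nodes G. \<exists>!\<pi>. is_path G n \<pi> m)"

definition unravel :: "('n, 'f) tgraph \<Rightarrow> 'n \<Rightarrow> ('f, 'n) pterm" where
  "unravel G n = (\<lambda>w.
     if \<exists>\<pi> m. is_path G n \<pi> m \<and> path_occ \<pi> = w
     then let m = (THE m. \<exists>\<pi>. is_path G n \<pi> m \<and> path_occ \<pi> = w)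
          in (case glab G m of None \<Rightarrow> Some (Inr m) | Some f \<Rightarrow> Some (Inl f))
     else None)"

text \<open>
  The square \<open>f' \<circ> f = g' \<circ> g\<close> from \<open>C\<close> via \<open>A\<close> and \<open>B\<close> to \<open>P\<close> is a pushout of term graphs. Term graphs
  being finite, it suffices to test the universal property on graphs whose nodes are natural
  numbers; \<open>is_pushout_universal\<close> below gives it for every node type.
\<close>

definition agree_on :: "'c set \<Rightarrow> ('c \<Rightarrow> 'd) \<Rightarrow> ('c \<Rightarrow> 'd) \<Rightarrow> bool" where
  "agree_on N f g \<longleftrightarrow> (\<forall>n\<in>N. f n = g n)"

definition is_pushout ::
    "('f \<Rightarrow> nat) \<Rightarrow> ('c, 'f) tgraph \<Rightarrow> ('a, 'f) tgraph \<Rightarrow> ('b, 'f) tgraph \<Rightarrow> ('p, 'f) tgraph \<Rightarrow>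
     ('c \<Rightarrow> 'a) \<Rightarrow> ('c \<Rightarrow> 'b) \<Rightarrow> ('a \<Rightarrow> 'p) \<Rightarrow> ('b \<Rightarrow> 'p) \<Rightarrow> bool" where
  "is_pushout ar C A B P f g f' g' \<longleftrightarrow>
     term_graph ar C \<and> term_graph ar A \<and> term_graph ar B \<and> term_graph ar P \<and>
     graph_morphism C A f \<and> graph_morphism C B g \<and>
     graph_morphism A P f' \<and> graph_morphism B P g' \<and>
     agree_on (nodes C) (f' \<circ> f) (g' \<circ> g) \<and>
     (\<forall>(Z :: (nat, 'f) tgraph) u v.
        term_graph ar Z \<and> graph_morphism A Z u \<and> graph_morphism B Z v \<and>
        agree_on (nodes C) (u \<circ> f) (v \<circ> g) \<longrightarrow>
        (\<exists>h. graph_morphism P Z h \<and>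
             agree_on (nodes A) (h \<circ> f') u \<and> agree_on (nodes B) (h \<circ> g') v \<and>
             (\<forall>h'. graph_morphism P Z h' \<and>
                   agree_on (nodes A) (h' \<circ> f') u \<and> agree_on (nodes B) (h' \<circ> g') v \<longrightarrow>
                   agree_on (nodes P) h' h)))"

lemma term_graph_nat_copy:
  fixes Z :: "('z, 'f) tgraph"
  assumes "term_graph ar Z"
  obtains Z' :: "(nat, 'f) tgraph" and e e' where
    "term_graph ar Z'" "graph_morphism Z Z' e" "graph_morphism Z' Z e'"
    "\<And>x. x \<in> nodes Z \<Longrightarrow> e' (e x) = x"
proof -
  obtain e :: "'z \<Rightarrow> nat" where inj: "inj_on e (nodes Z)"
    using assms finite_imp_inj_to_nat_seg unfolding term_graph_def by meson
  define e' where "e' = inv_into (nodes Z) e"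
  have e': "e' (e x) = x" if "x \<in> nodes Z" for x
    using inj that by (simp add: e'_def)
  define Z' where "Z' = \<lparr>nodes = e ` nodes Z,
    gsucc = (\<lambda>y. if y \<in> e ` nodes Z then map_option (map e) (gsucc Z (e' y)) else None),
    glab = (\<lambda>y. if y \<in> e ` nodes Z then glab Z (e' y) else None)\<rparr>"
  have dom: "gsucc Z x = None \<longleftrightarrow> glab Z x = None" for x
    using assms unfolding term_graph_def by (metis domIff)
  have succ: "set ss \<subseteq> nodes Z \<and> length ss = ar f" if "gsucc Z x = Some ss" "glab Z x = Some f" for x ss f
    using assms that unfolding term_graph_def by blast
  have "term_graph ar Z'"
    unfolding term_graph_def
  proof (intro conjI allI impI)
    show "finite (nodes Z')" using assms by (simp add: term_graph_def Z'_def)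
    show "dom (gsucc Z') = dom (glab Z')" 
      by (simp add: Z'_def dom_def dom del: not_None_eq)
    show "dom (glab Z') \<subseteq> nodes Z'" by (auto simp: Z'_def split: if_splits)
    fix y ss f assume y: "gsucc Z' y = Some ss \<and> glab Z' y = Some f"
    then have "y \<in> e ` nodes Z" by (auto simp: Z'_def split: if_splits)
    then obtain x where x: "x \<in> nodes Z" "y = e x" by blast
    with y obtain ss' where ss': "gsucc Z x = Some ss'" "ss = map e ss'" "glab Z x = Some f"
      by (auto simp: Z'_def e')
    with succ[OF ss'(1,3)] show "set ss \<subseteq> nodes Z'" "length ss = ar f"
      by (auto simp: Z'_def)
  qed
  moreover have "graph_morphism Z Z' e"
    by (auto simp: graph_morphism_def Z'_def e')
  moreover have "graph_morphism Z' Z e'"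
    unfolding graph_morphism_def
  proof (intro conjI ballI impI)
    show "e' ` nodes Z' \<subseteq> nodes Z" by (auto simp: Z'_def e')
    fix y assume "y \<in> nodes Z'" "glab Z' y \<noteq> None"
    then obtain x where x: "x \<in> nodes Z" "y = e x" by (auto simp: Z'_def)
    show "glab Z (e' y) = glab Z' y" using x by (simp add: Z'_def e')
    have "map (e' \<circ> e) ss = ss" if "gsucc Z x = Some ss" for ss
    proof -
      have "glab Z x \<noteq> None" using dom[of x] that by simp
      then obtain f where "glab Z x = Some f" by blast
      with succ[OF that] have "set ss \<subseteq> nodes Z" by blast
      then show ?thesis by (auto intro!: map_idI simp: e' subset_iff)
    qed
    then show "gsucc Z (e' y) = map_option (map e') (gsucc Z' y)"
      using x by (cases "gsucc Z x") (auto simp: Z'_def e')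
  qed
  ultimately show ?thesis using that e' by blast
qed

lemma graph_morphism_comp:
  assumes "graph_morphism G H f" "graph_morphism H K g"
  shows "graph_morphism G K (g \<circ> f)"
  using assms unfolding graph_morphism_def
  by (auto simp: image_subset_iff option.map_comp comp_def)

lemma is_pushout_universal:
  fixes Z :: "('z, 'f) tgraph"
  assumes po: "is_pushout ar C A B P f g f' g'"
    and Z: "term_graph ar Z" "graph_morphism A Z u" "graph_morphism B Z v"
    and comm: "agree_on (nodes C) (u \<circ> f) (v \<circ> g)"
  shows "\<exists>h. graph_morphism P Z h \<and>
             agree_on (nodes A) (h \<circ> f') u \<and> agree_on (nodes B) (h \<circ> g') v \<and>
             (\<forall>h'. graph_morphism P Z h' \<and>
                   agree_on (nodes A) (h' \<circ> f') u \<and> agree_on (nodes B) (h' \<circ> g') v \<longrightarrow>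
                   agree_on (nodes P) h' h)"
proof -
  obtain Z' :: "(nat, 'f) tgraph" and e e' where
    Z': "term_graph ar Z'" "graph_morphism Z Z' e" "graph_morphism Z' Z e'"
    and e': "\<And>x. x \<in> nodes Z \<Longrightarrow> e' (e x) = x"
    using term_graph_nat_copy[OF Z(1)] by blast
  have uA: "u a \<in> nodes Z" if "a \<in> nodes A" for a using Z(2) that by (auto simp: graph_morphism_def)
  have vB: "v b \<in> nodes Z" if "b \<in> nodes B" for b using Z(3) that by (auto simp: graph_morphism_def)
  have comm': "agree_on (nodes C) ((e \<circ> u) \<circ> f) ((e \<circ> v) \<circ> g)"
    using comm by (simp add: agree_on_def)
  have univ: "\<And>(Z :: (nat, 'f) tgraph) u v.
      term_graph ar Z \<Longrightarrow> graph_morphism A Z u \<Longrightarrow> graph_morphism B Z v \<Longrightarrow>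
      agree_on (nodes C) (u \<circ> f) (v \<circ> g) \<Longrightarrow>
      \<exists>h. graph_morphism P Z h \<and>
          agree_on (nodes A) (h \<circ> f') u \<and> agree_on (nodes B) (h \<circ> g') v \<and>
          (\<forall>h'. graph_morphism P Z h' \<and>
                agree_on (nodes A) (h' \<circ> f') u \<and> agree_on (nodes B) (h' \<circ> g') v \<longrightarrow>
                agree_on (nodes P) h' h)"
    using po unfolding is_pushout_def by (elim conjE) (elim allE impE, intro conjI, assumption+)
  from univ[OF Z'(1) graph_morphism_comp[OF Z(2) Z'(2)] graph_morphism_comp[OF Z(3) Z'(2)] comm']
  obtain h where h: "graph_morphism P Z' h"
      "agree_on (nodes A) (h \<circ> f') (e \<circ> u)" "agree_on (nodes B) (h \<circ> g') (e \<circ> v)"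
    and uniq: "\<forall>h'. graph_morphism P Z' h' \<and>
      agree_on (nodes A) (h' \<circ> f') (e \<circ> u) \<and> agree_on (nodes B) (h' \<circ> g') (e \<circ> v) \<longrightarrow>
      agree_on (nodes P) h' h"
    by (elim exE conjE)
  show ?thesis
  proof (intro exI[of _ "e' \<circ> h"] conjI allI impI)
    show "graph_morphism P Z (e' \<circ> h)" using graph_morphism_comp[OF h(1) Z'(3)] .
    show "agree_on (nodes A) (e' \<circ> h \<circ> f') u" using h(2) uA e' by (simp add: agree_on_def)
    show "agree_on (nodes B) (e' \<circ> h \<circ> g') v" using h(3) vB e' by (simp add: agree_on_def)
    fix h' assume h': "graph_morphism P Z h' \<and>
      agree_on (nodes A) (h' \<circ> f') u \<and> agree_on (nodes B) (h' \<circ> g') v"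
    then have "agree_on (nodes P) (e \<circ> h') h"
      using uniq[rule_format, of "e \<circ> h'"] graph_morphism_comp[OF _ Z'(2), of P h']
      by (simp add: agree_on_def)
    moreover have "h' x \<in> nodes Z" if "x \<in> nodes P" for x
      using h' that by (auto simp: graph_morphism_def)
    ultimately show "agree_on (nodes P) h' (e' \<circ> h)"
      using e' by (fastforce simp: agree_on_def dest: bspec)
  qed
qed

section \<open>Evaluation rules and direct derivations\<close>

definition unlabel :: "('n, 'f) tgraph \<Rightarrow> 'n \<Rightarrow> ('n, 'f) tgraph" where
  "unlabel G n = G\<lparr>gsucc := (gsucc G)(n := None), glab := (glab G)(n := None)\<rparr>"

text \<open>A span \<open>lhs \<leftarrow> itf \<rightarrow> rhs\<close> of term graphs, with a designated node of the left-hand side.\<close>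

record ('l, 'r, 'f) eval_rule =
  lhs :: "('l, 'f) tgraph"
  itf :: "('l, 'f) tgraph"
  rhs :: "('r, 'f) tgraph"
  lmor :: "'l \<Rightarrow> 'l"
  rmor :: "'l \<Rightarrow> 'r"
  rule_root :: "'l"

definition evaluation_rule :: "('f \<Rightarrow> nat) \<Rightarrow> ('l, 'r, 'f) eval_rule \<Rightarrow> bool" where
  "evaluation_rule ar p \<longleftrightarrow>
     term_graph ar (lhs p) \<and> term_graph ar (itf p) \<and> term_graph ar (rhs p) \<and>
     graph_morphism (itf p) (lhs p) (lmor p) \<and> inj_on (lmor p) (nodes (itf p)) \<and>
     graph_morphism (itf p) (rhs p) (rmor p) \<and> inj_on (rmor p) (nodes (itf p)) \<and>
     is_tree (lhs p) (rule_root p) \<and>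
     \<not> (nodes (lhs p) = {rule_root p} \<and> glab (lhs p) (rule_root p) = None) \<and>
     itf p = unlabel (lhs p) (rule_root p) \<and>
     (\<forall>n\<in>nodes (itf p). lmor p n = n) \<and>
     bij_betw (rmor p) (var_nodes (lhs p)) (var_nodes (rhs p))"

definition unravel_rule :: "('l, 'r, 'f) eval_rule \<Rightarrow> ('f, 'l) trule" where
  "unravel_rule p =
     (unravel (lhs p) (rule_root p),
      tsubst (unravel (rhs p) (rmor p (rule_root p)))
        (\<lambda>x. var_term (inv_into (var_nodes (lhs p)) (rmor p) x)))"

text \<open>
  Overlaps are unifications of terms renamed apart. Instead of renaming, the two terms are
  instantiated by independent substitutions.
\<close>

definition unify_apart :: "('f \<Rightarrow> nat) \<Rightarrow> ('f, 'v) pterm \<Rightarrow> ('f, 'v) pterm \<Rightarrow> bool" where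
  "unify_apart ar s t \<longleftrightarrow>
     (\<exists>\<sigma> \<sigma>' :: 'v \<Rightarrow> ('f, 'v) pterm.
        (\<forall>x. \<sigma> x \<in> CT ar UNIV \<and> \<sigma>' x \<in> CT ar UNIV) \<and> tsubst s \<sigma> = tsubst t \<sigma>')"

definition non_self_overlapping :: "('f \<Rightarrow> nat) \<Rightarrow> ('l, 'r, 'f) eval_rule \<Rightarrow> bool" where
  "non_self_overlapping ar p \<longleftrightarrow>
     (let l = fst (unravel_rule p) in
      \<forall>w\<in>dom l. w \<noteq> [] \<and> \<not> is_var_term (subterm_at l w) \<longrightarrow>
        \<not> unify_apart ar l (subterm_at l w))"

text \<open>
  Double-pushout diagram: \<open>k\<close> and \<open>h\<close> are the middle and right vertical morphisms, \<open>d\<close> and \<open>b\<close> the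
  lower horizontal ones.
\<close>

definition direct_derivation ::
    "('f \<Rightarrow> nat) \<Rightarrow> ('l, 'r, 'f) eval_rule \<Rightarrow> ('n, 'f) tgraph \<Rightarrow> ('c, 'f) tgraph \<Rightarrow> ('m, 'f) tgraph \<Rightarrow>
     ('l \<Rightarrow> 'n) \<Rightarrow> ('l \<Rightarrow> 'c) \<Rightarrow> ('r \<Rightarrow> 'm) \<Rightarrow> ('c \<Rightarrow> 'n) \<Rightarrow> ('c \<Rightarrow> 'm) \<Rightarrow> bool" where
  "direct_derivation ar p G D H g k h d b \<longleftrightarrow>
     is_pushout ar (itf p) (lhs p) D G (lmor p) k g d \<and>
     is_pushout ar (itf p) (rhs p) D H (rmor p) k h b"

definition track_subst ::
    "('n, 'f) tgraph \<Rightarrow> ('n \<Rightarrow> 'm) \<Rightarrow> 'm \<Rightarrow> ('f, 'n) pterm" where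
  "track_subst G tr x =
     (if \<exists>y\<in>var_nodes G. tr y = x then var_term (THE y. y \<in> var_nodes G \<and> tr y = x)
      else bottom_term)"

end

(*
  Contracting in the unraveling every occurrence of the evaluated node q amounts to continuing, at
  each such occurrence, in the unraveling of R and returning to G at the variables of the rule.
  This is the unraveling of H, because H carries at tr(q) the label and the successors of the root
  of R, and those of G at all other nodes; a comparison morphism from H into an explicit gluing of
  D and R shows that tr neither identifies nor labels variable nodes of G.
  For finitely many redexes the contraction is reached by contracting innermost redexes first, which
  leaves the others untouched. In the infinite case the unraveling is approximated by cutting off
  all redexes of depth at least i, so that every redex is either intact or removed as a whole.
*)
theory Submission
  imports Defs
begin

section \<open>Terms and substitutions\<close>

text \<open>The obstacle is that contracting a redex copies and moves the redexes inside it.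
  Contraction is therefore indexed by positions of the original term:
  \<open>contract l r t P v\<close> is the result for the subterm at \<open>v\<close>, and the
  copies made by \<open>r\<close> merely share an index, so they need not be followed. Most
  comparisons then become inductions on the length of the occurrence that is read, for all positions
  at once. These inductions go through because \<open>r\<close> has a function symbol at its root: a
  variable of \<open>r\<close> is reached only after a symbol has been consumed. The contraction and
  the unraveling of \<open>H\<close> satisfy the same guarded equations and hence coincide. On the
  graph side two negative facts about \<open>H\<close> are needed: no identification and no new
  label. Morphisms preserve equality of nodes and labels forward, so both can be read off from a
  single morphism out of \<open>H\<close>; its target only has to complete a commuting square, and
  need not be shown to be a pushout.\<close>

lemma tsubst_root_None: "s [] = None \<Longrightarrow> tsubst s \<sigma> = bottom_term"
proof
  fix w assume "s [] = None" then show "tsubst s \<sigma> w = bottom_term w"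
    by (cases w) (simp_all add: bottom_term_def)
qed

lemma tsubst_root_var: "s [] = Some (Inr x) \<Longrightarrow> tsubst s \<sigma> = \<sigma> x"
proof
  fix w assume "s [] = Some (Inr x)" then show "tsubst s \<sigma> w = \<sigma> x w"
    by (cases w) simp_all
qed

lemma subterm_at_tsubst:
  "s [] = Some (Inl f) \<Longrightarrow> subterm_at (tsubst s \<sigma>) [j] = tsubst (subterm_at s [j]) \<sigma>"
  by (simp add: subterm_at_def)

lemma term_varsI: "s w = Some (Inr x) \<Longrightarrow> x \<in> term_vars s"
  by (auto simp: term_vars_def)

lemma term_vars_subterm_at: "term_vars (subterm_at s w) \<subseteq> term_vars s"
  by (auto simp: term_vars_def subterm_at_def)

text \<open>The substitution is consulted only at suffixes of \<open>w\<close>, hence the length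
  bound. Equality as \<open>Q\<close> gives congruence, the definedness order gives
  monotonicity.\<close>

lemma tsubst_rel:
  assumes refl: "\<And>a. Q a a"
    and "\<And>x u. x \<in> term_vars s \<Longrightarrow> length u \<le> length w \<Longrightarrow> Q (\<sigma> x u) (\<sigma>' x u)"
  shows "Q (tsubst s \<sigma> w) (tsubst s \<sigma>' w)"
  using assms(2)
proof (induction w arbitrary: s)
  case Nil
  then show ?case using refl by (auto simp: term_vars_def split: option.split sum.split)
next
  case (Cons j w)
  have "Q (tsubst (subterm_at s [j]) \<sigma> w) (tsubst (subterm_at s [j]) \<sigma>' w)"
    using term_vars_subterm_at[of s "[j]"] by (intro Cons.IH Cons.prems) auto
  then show ?case
    using refl Cons.prems[of _ "j # w"] by (auto split: option.split sum.split dest: term_varsI)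
qed

text \<open>The function symbol at the root uses up one symbol of \<open>w\<close> before any
  variable is reached. This strict bound is what carries inductions through right-hand
  sides.\<close>

lemma tsubst_rel_strict:
  assumes "s [] = Some (Inl f)" and refl: "\<And>a. Q a a"
    and "\<And>x u. x \<in> term_vars s \<Longrightarrow> length u < length w \<Longrightarrow> Q (\<sigma> x u) (\<sigma>' x u)"
  shows "Q (tsubst s \<sigma> w) (tsubst s \<sigma>' w)"
proof (cases w)
  case Nil
  then show ?thesis using assms by simp
next
  case (Cons j u)
  have "Q (tsubst (subterm_at s [j]) \<sigma> u) (tsubst (subterm_at s [j]) \<sigma>' u)"
    using term_vars_subterm_at[of s "[j]"] Cons
    by (intro tsubst_rel[of Q] refl assms(3)) auto
  then show ?thesis using Cons assms(1) by simp
qed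

lemma tsubst_cong_strict:
  assumes "s [] = Some (Inl f)"
    and "\<And>x u. x \<in> term_vars s \<Longrightarrow> length u < length w \<Longrightarrow> \<sigma> x u = \<sigma>' x u"
  shows "tsubst s \<sigma> w = tsubst s \<sigma>' w"
  by (rule tsubst_rel_strict[where Q = "(=)" and s = s and f = f]) (simp_all add: assms)

lemma tsubst_cong:
  assumes "\<And>x. x \<in> term_vars s \<Longrightarrow> \<sigma> x = \<sigma>' x"
  shows "tsubst s \<sigma> = tsubst s \<sigma>'"
proof
  fix w show "tsubst s \<sigma> w = tsubst s \<sigma>' w"
    by (rule tsubst_rel) (simp_all add: assms)
qed

lemma tsubst_tsubst: "tsubst (tsubst s \<sigma>) \<theta> = tsubst s (\<lambda>x. tsubst (\<sigma> x) \<theta>)"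
proof
  fix w show "tsubst (tsubst s \<sigma>) \<theta> w = tsubst s (\<lambda>x. tsubst (\<sigma> x) \<theta>) w"
  proof (induction w arbitrary: s)
    case Nil
    show ?case by (auto split: option.split sum.split)
  next
    case (Cons j w)
    show ?case
    proof (cases "s []")
      case None
      then show ?thesis by simp
    next
      case (Some a)
      then show ?thesis
        using Cons by (cases a) (simp_all add: subterm_at_tsubst tsubst_root_var)
    qed
  qed
qed

lemma term_vars_tsubst: "term_vars (tsubst s \<sigma>) \<subseteq> (\<Union>x\<in>term_vars s. term_vars (\<sigma> x))"
proof -
  have "\<exists>x\<in>term_vars s. y \<in> term_vars (\<sigma> x)" if "tsubst s \<sigma> w = Some (Inr y)" for w y
    using that
  proof (induction w arbitrary: s)
    case Nil
    then show ?case by (force simp: term_vars_def split: option.splits sum.splits)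
  next
    case (Cons j w)
    show ?case
    proof (cases "\<exists>x. s [] = Some (Inr x)")
      case True
      then show ?thesis using Cons.prems by (auto intro!: bexI term_varsI)
    next
      case False
      then have "tsubst (subterm_at s [j]) \<sigma> w = Some (Inr y)"
        using Cons.prems by (auto split: option.splits sum.splits)
      then show ?thesis using Cons.IH term_vars_subterm_at by fast
    qed
  qed
  then show ?thesis unfolding term_vars_def[of "tsubst s \<sigma>"] by blast
qed

section \<open>Closure properties of well-formed and of total terms\<close>

lemma bottom_CT: "bottom_term \<in> CT ar X"
  by (simp add: CT_def bottom_term_def term_vars_def)

lemma CT_varD: "t \<in> CT ar X \<Longrightarrow> t w = Some (Inr x) \<Longrightarrow> x \<in> X"
  unfolding CT_def by (auto dest: term_varsI)

lemma CT_snocD: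
  assumes "t \<in> CT ar X" "t (w @ [i]) \<noteq> None"
  shows "\<exists>f. t w = Some (Inl f) \<and> 0 < i \<and> i \<le> ar f"
  using assms unfolding CT_def by (auto simp del: not_None_eq)

lemma CT_appendD:
  assumes "t \<in> CT ar X" "t (w @ u) \<noteq> None" "u \<noteq> []"
  shows "\<exists>f. t w = Some (Inl f)"
  using assms(2,3)
proof (induction u rule: rev_induct)
  case Nil
  then show ?case by simp
next
  case (snoc i u)
  then have "\<exists>f. t (w @ u) = Some (Inl f)" using CT_snocD[OF assms(1), of "w @ u" i] by auto
  then show ?case using snoc.IH by (cases "u = []") auto
qed

lemma subterm_at_CT:
  assumes "t \<in> CT ar X"
  shows "subterm_at t w \<in> CT ar X"
proof -
  have "\<exists>f. t (w @ v) = Some (Inl f) \<and> 0 < i \<and> i \<le> ar f" if "t (w @ v @ [i]) \<noteq> None" for v i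
    using CT_snocD[OF assms, of "w @ v" i] that by simp
  moreover have "term_vars (subterm_at t w) \<subseteq> X"
    using term_vars_subterm_at[of t w] assms by (auto simp: CT_def)
  ultimately show ?thesis unfolding CT_def subterm_at_def by blast
qed

lemma tsubst_CT:
  assumes s: "s \<in> CT ar Y" and \<sigma>: "\<And>x. \<sigma> x \<in> CT ar X"
  shows "tsubst s \<sigma> \<in> CT ar X"
proof -
  have "\<exists>f. tsubst s \<sigma> w = Some (Inl f) \<and> 0 < i \<and> i \<le> ar f"
    if "tsubst s \<sigma> (w @ [i]) \<noteq> None" for w i
    using that s
  proof (induction w arbitrary: s)
    case Nil
    show ?case
    proof (cases "s []")
      case None
      then show ?thesis using Nil by simp
    next
      case (Some a)
      show ?thesis
      proof (cases a)
        case (Inl f)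
        then have "s ([] @ [i]) \<noteq> None"
          using Nil.prems Some by (auto simp: subterm_at_def split: option.splits)
        then show ?thesis using CT_snocD[OF Nil.prems(2)] Some Inl by fastforce
      next
        case (Inr x)
        then show ?thesis using Nil Some CT_snocD[OF \<sigma>, of x "[]" i] by simp
      qed
    qed
  next
    case (Cons j w)
    show ?case
    proof (cases "s []")
      case None
      then show ?thesis using Cons by simp
    next
      case (Some a)
      show ?thesis
      proof (cases a)
        case (Inl f)
        then show ?thesis using Cons Some subterm_at_CT[OF Cons.prems(2)] by simp
      next
        case (Inr x)
        then show ?thesis using Cons Some CT_snocD[OF \<sigma>, of x "j # w" i] by simp
      qed
    qed
  qed
  moreover have "term_vars (tsubst s \<sigma>) \<subseteq> X"
    using term_vars_tsubst[of s \<sigma>] \<sigma> unfolding CT_def by blast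
  ultimately show ?thesis unfolding CT_def by blast
qed

lemma var_term_CT: "x \<in> X \<Longrightarrow> var_term x \<in> CT ar X"
  by (auto simp: CT_def var_term_def term_vars_def)

lemma total_term_subterm_at: "total_term ar t \<Longrightarrow> total_term ar (subterm_at t w)"
  unfolding total_term_def subterm_at_def by (metis (lifting) append_assoc domIff)

text \<open>An undefined \<open>\<sigma> x\<close> would turn an existing child of \<open>s\<close>
  into a missing one, hence the condition at \<open>[]\<close>.\<close>

lemma total_term_tsubst:
  assumes s: "total_term ar s"
    and \<sigma>: "\<And>x. total_term ar (\<sigma> x)" "\<And>x. \<sigma> x [] \<noteq> None"
  shows "total_term ar (tsubst s \<sigma>)"
proof -
  have "tsubst s \<sigma> (w @ [i]) \<noteq> None"
    if "tsubst s \<sigma> w = Some (Inl f)" "0 < i" "i \<le> ar f" for w f i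
    using that(1) s
  proof (induction w arbitrary: s)
    case Nil
    show ?case
    proof (cases "\<exists>x. s [] = Some (Inr x)")
      case True
      then obtain x where x: "s [] = Some (Inr x)" by blast
      then have "\<sigma> x ([] @ [i]) \<noteq> None"
        using Nil.prems(1) \<sigma>(1)[of x] that(2,3) unfolding total_term_def
        by (metis domIff tsubst_root_var)
      then show ?thesis using x by simp
    next
      case False
      then have f: "s [] = Some (Inl f)"
        using Nil.prems by (auto split: option.splits sum.splits)
      then have "s ([] @ [i]) \<noteq> None" using Nil.prems(2) that unfolding total_term_def by blast
      then show ?thesis using f \<sigma>(2) by (auto simp: subterm_at_def split: sum.split)
    qed
  next
    case (Cons j w)
    show ?case
    proof (cases "\<exists>x. s [] = Some (Inr x)")
      case True
      then obtain x where x: "s [] = Some (Inr x)" by blast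
      then have "\<sigma> x ((j # w) @ [i]) \<noteq> None"
        using Cons.prems(1) \<sigma>(1)[of x] that(2,3) unfolding total_term_def
        by (metis domIff tsubst_root_var)
      then show ?thesis using x by simp
    next
      case False
      then obtain f' where f': "s [] = Some (Inl f')"
        and *: "tsubst (subterm_at s [j]) \<sigma> w = Some (Inl f)"
        using Cons.prems(1) by (auto split: option.splits sum.splits)
      have "total_term ar (subterm_at s [j])"
        using Cons.prems(2) by (rule total_term_subterm_at)
      then show ?thesis using Cons.IH[OF *] f' by simp
    qed
  qed
  then show ?thesis unfolding total_term_def by blast
qed

lemma total_term_var_term: "total_term ar (var_term x)"
  by (simp add: total_term_def var_term_def)

text \<open>Any upper bound agrees with \<open>t\<close> wherever some \<open>T i\<close> is
  defined, so it is enough that the domains exhaust that of \<open>t\<close>.\<close>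

lemma term_lubI:
  assumes "t \<in> CT ar X" "\<And>i. T i \<subseteq>\<^sub>m t" "\<And>w. w \<in> dom t \<Longrightarrow> \<exists>i. w \<in> dom (T i)"
  shows "term_lub ar X T t"
proof -
  have "t w = s w" if "w \<in> dom t" "\<forall>i. T i \<subseteq>\<^sub>m s" for w s
    using assms(2,3) that unfolding map_le_def by metis
  then show ?thesis using assms(1,2) unfolding term_lub_def map_le_def by blast
qed

section \<open>Contraction of a set of redexes\<close>

text \<open>Below a redex, the argument bound to \<open>x\<close> sits at this occurrence. The value
  is meaningful only if \<open>x\<close> occurs exactly once in \<open>l\<close>.\<close>

definition var_occ :: "('f, 'l) pterm \<Rightarrow> 'l \<Rightarrow> nat list" where
  "var_occ l x = (THE w. l w = Some (Inr x))"

text \<open>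
  Contracting the positions in \<open>P\<close> below \<open>v\<close> is a recursion that consumes no symbol when it enters
  \<open>r\<close>. It is productive only if the root of \<open>r\<close> is a function symbol, hence the recursion on fuel.
\<close>

primrec contract_upto ::
    "('f, 'l) pterm \<Rightarrow> ('f, 'l) pterm \<Rightarrow> ('f, 'x) pterm \<Rightarrow> nat list set \<Rightarrow> nat \<Rightarrow> nat list \<Rightarrow> ('f, 'x) pterm"
  where
  "contract_upto l r t P 0 v = bottom_term"
| "contract_upto l r t P (Suc k) v =
     (if v \<in> P then tsubst r (\<lambda>x. contract_upto l r t P k (v @ var_occ l x))
      else (\<lambda>w. case w of [] \<Rightarrow> t v | j # u \<Rightarrow> contract_upto l r t P k (v @ [j]) u))"

definition contract ::
    "('f, 'l) pterm \<Rightarrow> ('f, 'l) pterm \<Rightarrow> ('f, 'x) pterm \<Rightarrow> nat list set \<Rightarrow> nat list \<Rightarrow> ('f, 'x) pterm"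
  where
  "contract l r t P v = (\<lambda>w. contract_upto l r t P (Suc (length w)) v w)"

text \<open>For left-linear \<open>l\<close>, matching amounts to agreement of function symbols; a
  variable may also match the empty term. The last conjunct lets redexes meet only at or below
  variables of \<open>l\<close>.\<close>

definition redex_occs ::
    "('f \<Rightarrow> nat) \<Rightarrow> 'x set \<Rightarrow> ('f, 'l) pterm \<Rightarrow> ('f, 'x) pterm \<Rightarrow> nat list set \<Rightarrow> bool" where
  "redex_occs ar X l t \<Phi> \<longleftrightarrow> t \<in> CT ar X \<and>
     (\<forall>w\<in>\<Phi>. \<forall>z f. l z = Some (Inl f) \<longrightarrow>
        t (w @ z) = Some (Inl f) \<and> (z \<noteq> [] \<longrightarrow> w @ z \<notin> \<Phi>))"

definition cut_at :: "nat list set \<Rightarrow> ('f, 'x) pterm \<Rightarrow> ('f, 'x) pterm" where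
  "cut_at C t = (\<lambda>v. if \<exists>u\<in>C. prefix u v then None else t v)"

lemma cut_at_CT:
  assumes "t \<in> CT ar X"
  shows "cut_at C t \<in> CT ar X"
proof -
  have "\<exists>f. cut_at C t w = Some (Inl f) \<and> 0 < i \<and> i \<le> ar f"
    if "cut_at C t (w @ [i]) \<noteq> None" for w i
    using that CT_snocD[OF assms, of w i] by (auto simp: cut_at_def split: if_splits)
  moreover have "term_vars (cut_at C t) \<subseteq> X"
    using assms by (auto simp: CT_def cut_at_def term_vars_def split: if_splits)
  ultimately show ?thesis unfolding CT_def by blast
qed

text \<open>Freedom from overlap is a condition on occurrences, stated by \<open>redex_occs\<close>,
  rather than on the rule.\<close>

locale orthogonal_rule =
  fixes ar :: "'f \<Rightarrow> nat" and l r :: "('f, 'l) pterm"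
  assumes rule: "term_rule ar (l, r)"
    and l_root: "\<exists>f. l [] = Some (Inl f)"
    and linear: "\<And>w w' x. l w = Some (Inr x) \<Longrightarrow> l w' = Some (Inr x) \<Longrightarrow> w = w'"
    and r_root: "\<exists>f. r [] = Some (Inl f)"
begin

lemma l_CT: "l \<in> CT ar UNIV" and r_CT: "r \<in> CT ar UNIV"
  and l_total: "total_term ar l" and vars: "term_vars r \<subseteq> term_vars l" and l_finite: "finite (dom l)"
  using rule by (auto simp: term_rule_def finite_term_def)

lemma var_occ_eq: "l w = Some (Inr x) \<Longrightarrow> var_occ l x = w"
  unfolding var_occ_def using linear by blast

lemma var_occ: "x \<in> term_vars l \<Longrightarrow> l (var_occ l x) = Some (Inr x)"
  using var_occ_eq by (fastforce simp: term_vars_def)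

lemma var_occ_not_Nil: "x \<in> term_vars l \<Longrightarrow> var_occ l x \<noteq> []"
  using var_occ l_root by fastforce

lemma tsubst_rhs_cong:
  assumes "\<And>x u. x \<in> term_vars r \<Longrightarrow> length u < length w \<Longrightarrow> \<sigma> x u = \<sigma>' x u"
  shows "tsubst r \<sigma> w = tsubst r \<sigma>' w"
  using r_root assms by (auto intro: tsubst_cong_strict)

text \<open>Every unit of fuel is paid for by a symbol of \<open>w\<close>: descending in
  \<open>t\<close> consumes one, and entering \<open>r\<close> consumes at least its root before the
  recursion resumes at a variable.\<close>

lemma contract_upto_cong:
  "length w < k \<Longrightarrow> length w < k' \<Longrightarrow>
    contract_upto l r t P k v w = contract_upto l r t P k' v w"
proof (induction k arbitrary: k' v w)
  case 0
  then show ?case by simp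
next
  case (Suc k)
  then obtain k'' where k': "k' = Suc k''" by (cases k') auto
  show ?case
  proof (cases "v \<in> P")
    case True
    have "tsubst r (\<lambda>x. contract_upto l r t P k (v @ var_occ l x)) w =
        tsubst r (\<lambda>x. contract_upto l r t P k'' (v @ var_occ l x)) w"
      by (intro tsubst_rhs_cong Suc.IH) (use Suc.prems k' in auto)
    then show ?thesis using True k' by simp
  next
    case False
    show ?thesis
    proof (cases w)
      case Nil
      then show ?thesis using False k' by simp
    next
      case (Cons j u)
      then show ?thesis using False k' Suc.prems Suc.IH[of u k'' "v @ [j]"] by simp
    qed
  qed
qed

lemma contract_eq_upto: "length w < k \<Longrightarrow> contract l r t P v w = contract_upto l r t P k v w"
  unfolding contract_def by (rule contract_upto_cong) auto

text \<open>Together with \<open>contract_Nil\<close> and \<open>contract_Cons\<close> this gives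
  equations for \<open>contract\<close> in which fuel no longer appears.\<close>

lemma contract_redex:
  assumes "v \<in> P"
  shows "contract l r t P v = tsubst r (\<lambda>x. contract l r t P (v @ var_occ l x))"
proof
  fix w
  have "tsubst r (\<lambda>x. contract_upto l r t P (length w) (v @ var_occ l x)) w =
      tsubst r (\<lambda>x. contract l r t P (v @ var_occ l x)) w"
    by (rule tsubst_rhs_cong) (auto simp: contract_eq_upto)
  then show "contract l r t P v w = tsubst r (\<lambda>x. contract l r t P (v @ var_occ l x)) w"
    using assms by (simp add: contract_def)
qed

lemma contract_Nil: "v \<notin> P \<Longrightarrow> contract l r t P v [] = t v"
  by (simp add: contract_def)

lemma contract_Cons: "v \<notin> P \<Longrightarrow> contract l r t P v (j # w) = contract l r t P (v @ [j]) w"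
  by (simp add: contract_def)

lemma contract_empty: "contract l r t {} v = subterm_at t v"
proof
  show "contract l r t {} v w = subterm_at t v w" for w
    by (induction w arbitrary: v) (simp_all add: contract_Nil contract_Cons subterm_at_def)
qed

text \<open>Without \<open>P \<subseteq> dom t\<close>, a position of \<open>P\<close> outside
  \<open>t\<close> would produce a copy of \<open>r\<close> out of nothing.\<close>

lemma contract_bottom:
  assumes "\<And>u. t (v @ u) = None" "P \<subseteq> dom t"
  shows "contract l r t P v = bottom_term"
proof
  show "contract l r t P v w = bottom_term w" for w
    using assms(1)
  proof (induction w arbitrary: v)
    case Nil
    then have "v \<notin> P" using assms(2) by (metis append_Nil2 domIff subsetD)
    then show ?case using Nil[of "[]"] by (simp add: contract_Nil bottom_term_def)
  next
    case (Cons j w)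
    then have "v \<notin> P" using assms(2) by (metis append_Nil2 domIff subsetD)
    moreover have "t ((v @ [j]) @ u) = None" for u using Cons.prems[of "j # u"] by simp
    ultimately show ?case using Cons.IH[of "v @ [j]"] by (simp add: contract_Cons bottom_term_def)
  qed
qed

text \<open>\<open>tsubst_CT\<close> wants the substituted terms in \<open>CT\<close> as wholes,
  which an induction on occurrences cannot offer. Hence the induction on fuel, followed by a
  transfer to \<open>contract\<close>.\<close>

lemma contract_CT:
  assumes t: "t \<in> CT ar X" and P: "P \<subseteq> dom t"
  shows "contract l r t P v \<in> CT ar X"
proof -
  have root: "t v \<noteq> None" if "contract_upto l r t P k v [] \<noteq> None" for k v
    using that P by (cases k) (auto simp: bottom_term_def split: if_splits)
  have upto: "contract_upto l r t P k v \<in> CT ar X" for k v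
  proof (induction k arbitrary: v)
    case 0
    show ?case using bottom_CT by simp
  next
    case (Suc k)
    show ?case
    proof (cases "v \<in> P")
      case True
      then show ?thesis using tsubst_CT[OF r_CT Suc] by simp
    next
      case False
      let ?s = "contract_upto l r t P (Suc k) v"
      have "\<exists>f. ?s w = Some (Inl f) \<and> 0 < i \<and> i \<le> ar f" if "?s (w @ [i]) \<noteq> None" for w i
      proof (cases w)
        case Nil
        then have "t (v @ [i]) \<noteq> None" using that False root by auto
        from CT_snocD[OF t this] show ?thesis using Nil False by simp
      next
        case (Cons j u)
        then show ?thesis using that False CT_snocD[OF Suc, of "v @ [j]" u i] by simp
      qed
      moreover have "x \<in> X" if "?s w = Some (Inr x)" for w x
      proof (cases w)
        case Nil
        then have "t v = Some (Inr x)" using that False by simp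
        then show ?thesis using CT_varD[OF t] by blast
      next
        case (Cons j u)
        then have "contract_upto l r t P k (v @ [j]) u = Some (Inr x)" using that False by simp
        then show ?thesis using CT_varD[OF Suc] by blast
      qed
      then have "term_vars ?s \<subseteq> X" by (auto simp: term_vars_def)
      ultimately show ?thesis unfolding CT_def by blast
    qed
  qed
  have "\<exists>f. contract l r t P v w = Some (Inl f) \<and> 0 < i \<and> i \<le> ar f"
    if "contract l r t P v (w @ [i]) \<noteq> None" for w i
  proof -
    \<comment> \<open>Enough fuel for \<open>w\<close> and for its extension by one symbol, so that
      a node and its child are compared in the same approximant.\<close>
    let ?s = "contract_upto l r t P (Suc (Suc (length w))) v"
    have eq: "contract l r t P v w = ?s w" "contract l r t P v (w @ [i]) = ?s (w @ [i])"
      by (rule contract_eq_upto; simp)+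
    show ?thesis using CT_snocD[OF upto that[unfolded eq]] unfolding eq .
  qed
  moreover have "x \<in> X" if "contract l r t P v w = Some (Inr x)" for w x
    using CT_varD[OF upto that[unfolded contract_def]] .
  then have "term_vars (contract l r t P v) \<subseteq> X" by (auto simp: term_vars_def)
  ultimately show ?thesis unfolding CT_def by blast
qed

section \<open>Finite sets of redexes: complete developments from the inside out\<close>

lemma contract_insert_not_prefix:
  assumes "\<not> prefix v w"
  shows "contract l r t (insert w Q) v = contract l r t Q v"
proof
  fix u
  show "contract l r t (insert w Q) v u = contract l r t Q v u"
    using assms
  proof (induction u arbitrary: v rule: length_induct)
    case (1 u)
    have ext: "\<not> prefix (v @ z) w" for z using 1(2) by (auto simp: prefix_def)
    have "v \<noteq> w" using 1(2) by auto
    show ?case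
    proof (cases "v \<in> Q")
      case True
      have "tsubst r (\<lambda>x. contract l r t (insert w Q) (v @ var_occ l x)) u =
          tsubst r (\<lambda>x. contract l r t Q (v @ var_occ l x)) u"
        by (rule tsubst_rhs_cong) (use 1(1) ext in auto)
      then show ?thesis using True by (simp add: contract_redex)
    next
      case False
      then show ?thesis using 1 \<open>v \<noteq> w\<close> ext[of "[_]"]
        by (cases u) (auto simp: contract_Nil contract_Cons)
    qed
  qed
qed

text \<open>Nothing properly above \<open>w\<close> is contracted, so positions in \<open>t\<close>
  and occurrences in the result coincide on the way to \<open>w\<close>.\<close>

lemma subterm_at_contract:
  assumes "\<And>q. q \<in> Q \<Longrightarrow> \<not> strict_prefix q w"
  shows "subterm_at (contract l r t Q []) w = contract l r t Q w"
proof -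
  have "subterm_at (contract l r t Q v) z = contract l r t Q w" if "w = v @ z" for v z
    using that
  proof (induction z arbitrary: v)
    case Nil
    then show ?case by (simp add: subterm_at_def)
  next
    case (Cons i z)
    have v: "v \<notin> Q" using assms[of v] Cons.prems by (auto simp: strict_prefix_def prefix_def)
    have "subterm_at (contract l r t Q v) (i # z) = subterm_at (contract l r t Q (v @ [i])) z"
      using v by (simp add: subterm_at_def contract_Cons)
    then show ?case using Cons.IH[of "v @ [i]"] Cons.prems by simp
  qed
  from this[of "[]" w] show ?thesis by simp
qed

text \<open>This is a single reduction step at \<open>w\<close>: the redex has not moved, since
  nothing above it is contracted, and the recursion started at its arguments never returns to
  \<open>w\<close>.\<close>

lemma contract_insert:
  assumes "\<And>q. q \<in> Q \<Longrightarrow> \<not> strict_prefix q w" "w \<notin> Q"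
  shows "contract l r t (insert w Q) [] = replace_at (contract l r t Q []) w
           (tsubst r (\<lambda>x. contract l r t Q (w @ var_occ l x)))"
proof -
  let ?s = "tsubst r (\<lambda>x. contract l r t Q (w @ var_occ l x))"
  have "contract l r t (insert w Q) v = replace_at (contract l r t Q v) z ?s" if "w = v @ z" for v z
    using that
  proof (induction z arbitrary: v)
    case Nil
    have "contract l r t (insert w Q) w = tsubst r (\<lambda>x. contract l r t (insert w Q) (w @ var_occ l x))"
      by (simp add: contract_redex)
    also have "\<dots> = ?s"
      using vars by (intro tsubst_cong contract_insert_not_prefix) (auto dest: var_occ_not_Nil)
    finally show ?case using Nil by (auto simp: replace_at_def)
  next
    case (Cons i z)
    have v: "v \<notin> insert w Q" using assms(1)[of v] Cons.prems by (auto simp: strict_prefix_def prefix_def)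
    show ?case
    proof
      fix u
      show "contract l r t (insert w Q) v u = replace_at (contract l r t Q v) (i # z) ?s u"
      proof (cases u)
        case Nil
        then show ?thesis using v by (simp add: contract_Nil replace_at_def)
      next
        case (Cons j u')
        show ?thesis
        proof (cases "j = i")
          case True
          then show ?thesis using Cons v Cons.IH[of "v @ [i]"] Cons.prems
            by (simp add: contract_Cons replace_at_def)
        next
          case False
          then have "\<not> prefix (v @ [j]) w" using Cons.prems by (auto simp: prefix_def)
          then show ?thesis using False Cons v
            by (simp add: contract_Cons replace_at_def contract_insert_not_prefix)
        qed
      qed
    qed
  qed
  from this[of "[]" w] show ?thesis by simp
qed

text \<open>Other redexes of \<open>\<Phi>\<close> avoid the function symbols of \<open>l\<close>
  placed at \<open>w\<close>, so contracting them changes only the arguments. With \<open>Q\<close>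
  empty this yields the redex in \<open>t\<close> itself.\<close>

lemma contract_match:
  assumes \<Phi>: "redex_occs ar X l t \<Phi>" and "w \<in> \<Phi>" "w \<notin> Q" "Q \<subseteq> \<Phi>"
  shows "contract l r t Q w = tsubst l (\<lambda>x. contract l r t Q (w @ var_occ l x))"
proof -
  let ?\<sigma> = "\<lambda>x. contract l r t Q (w @ var_occ l x)"
  have t: "t \<in> CT ar X" using \<Phi> by (simp add: redex_occs_def)
  have match: "t (w' @ z) = Some (Inl f)" "z \<noteq> [] \<Longrightarrow> w @ z \<notin> \<Phi>"
    if "w' \<in> \<Phi>" "l z = Some (Inl f)" for w' z f
    using \<Phi> that \<open>w \<in> \<Phi>\<close> unfolding redex_occs_def by blast+
  have dom: "Q \<subseteq> dom t" using match(1)[of _ "[]"] l_root assms(4) by auto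
  have "contract l r t Q (w @ z) u = tsubst (subterm_at l z) ?\<sigma> u" if "l z \<noteq> None" for z u
    using that
  proof (induction u arbitrary: z)
    case Nil
    then obtain a where a: "l z = Some a" by blast
    show ?case
    proof (cases a)
      case (Inl f)
      then have "w @ z \<notin> Q" using match(2)[of w z f] a assms by (cases "z = []") auto
      then show ?thesis using match(1)[of w z f] a Inl assms
        by (simp add: contract_Nil subterm_at_def)
    next
      case (Inr x)
      then show ?thesis using a var_occ_eq by (simp add: subterm_at_def)
    qed
  next
    case (Cons j u)
    then obtain a where a: "l z = Some a" by blast
    show ?case
    proof (cases a)
      case (Inl f)
      then have z: "w @ z \<notin> Q" using match(2)[of w z f] a assms by (cases "z = []") auto
      have *: "tsubst (subterm_at l z) ?\<sigma> (j # u) = tsubst (subterm_at l (z @ [j])) ?\<sigma> u"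
        using a Inl by (simp add: subterm_at_def)
      show ?thesis
      proof (cases "l (z @ [j]) = None")
        case True
        \<comment> \<open>As \<open>l\<close> is total, a child missing in \<open>l\<close> has an
          index outside the arity of \<open>f\<close>; \<open>t\<close> carries the same
          \<open>f\<close> and has no such child either.\<close>
        have "t ((w @ z @ [j]) @ v) = None" for v
        proof (rule ccontr)
          assume "t ((w @ z @ [j]) @ v) \<noteq> None"
          then have "t ((w @ z) @ [j]) \<noteq> None"
            using CT_appendD[OF t, of "w @ z @ [j]" v] by (cases "v = []") auto
          from CT_snocD[OF t this] have "0 < j" "j \<le> ar f"
            using match(1)[of w z f] a Inl assms by auto
          then show False using l_total a Inl True unfolding total_term_def by blast
        qed
        then have "contract l r t Q (w @ z @ [j]) = bottom_term"
          using dom by (intro contract_bottom) auto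
        moreover have "tsubst (subterm_at l (z @ [j])) ?\<sigma> = bottom_term"
          using True by (intro tsubst_root_None) (simp add: subterm_at_def)
        ultimately show ?thesis using z * by (simp add: contract_Cons)
      next
        case False
        then show ?thesis using Cons.IH[of "z @ [j]"] z * by (simp add: contract_Cons)
      qed
    next
      case (Inr x)
      then show ?thesis using a var_occ_eq by (simp add: subterm_at_def)
    qed
  qed
  from this[of "[]"] l_root show ?thesis by (fastforce simp: subterm_at_def)
qed

lemma redex_occs_dom:
  assumes "redex_occs ar X l t \<Phi>"
  shows "\<Phi> \<subseteq> dom t"
proof
  fix w assume "w \<in> \<Phi>"
  moreover obtain f where "l [] = Some (Inl f)" using l_root by blast
  ultimately have "t (w @ []) = Some (Inl f)" using assms unfolding redex_occs_def by blast
  then show "w \<in> dom t" by auto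
qed

lemma redex_occs_is_redex:
  assumes "redex_occs ar X l t \<Phi>" "w \<in> \<Phi>"
  shows "is_redex ar X t (w, (l, r))"
proof -
  have "subterm_at t w = tsubst l (\<lambda>x. subterm_at t (w @ var_occ l x))"
    using contract_match[OF assms, of "{}"] by (simp add: contract_empty)
  moreover have "subterm_at t v \<in> CT ar X" for v
    using assms subterm_at_CT by (auto simp: redex_occs_def)
  ultimately show ?thesis using rule unfolding is_redex_def prod.case
    by (intro conjI exI[of _ "\<lambda>x. subterm_at t (w @ var_occ l x)"] allI)
qed

text \<open>\<open>Q\<close> holds the redexes already contracted and \<open>P\<close> those still
  to come; the invariant is that no member of \<open>Q\<close> lies properly above one of
  \<open>P\<close>.\<close>

lemma complete_dev_contract:
  assumes \<Phi>: "redex_occs ar X l t \<Phi>" and "finite P" "P \<union> Q \<subseteq> \<Phi>" "P \<inter> Q = {}"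
    and "\<And>w q. w \<in> P \<Longrightarrow> q \<in> Q \<Longrightarrow> \<not> strict_prefix q w"
  shows "complete_dev ar X ((\<lambda>w. (w, (l, r))) ` P) (contract l r t Q []) (contract l r t (P \<union> Q) [])"
  using assms(2-)
proof (induction "card P" arbitrary: P Q)
  case 0
  then show ?case by (auto intro: dev_done)
next
  case (Suc k)
  then have "P \<noteq> {}" by auto
  \<comment> \<open>A longest member of \<open>P\<close> has no member of \<open>P\<close> properly
    below it.\<close>
  then obtain w where w: "w \<in> P" "length w = Max (length ` P)"
    using Suc.prems(1) Max_in[of "length ` P"] by fastforce
  let ?\<Delta> = "(w, (l, r))"
  have nostrict: "\<not> strict_prefix w v" if "v \<in> P" for v
  proof -
    have "length v \<le> Max (length ` P)" using Suc.prems(1) that by simp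
    then show ?thesis using w(2) prefix_length_less[of w v] by auto
  qed
  have CT: "contract l r t Q v \<in> CT ar X" for v
    using \<Phi> redex_occs_dom[OF \<Phi>] Suc.prems by (intro contract_CT) (auto simp: redex_occs_def)
  have red: "reduce ar X (contract l r t Q []) ?\<Delta> (contract l r t (insert w Q) [])"
    unfolding reduce_def prod.case
  proof (intro conjI exI)
    show "term_rule ar (l, r)" by (rule rule)
    show "\<forall>x. contract l r t Q (w @ var_occ l x) \<in> CT ar X" using CT by blast
    show "subterm_at (contract l r t Q []) w = tsubst l (\<lambda>x. contract l r t Q (w @ var_occ l x))"
      using w Suc.prems by (subst subterm_at_contract) (auto intro!: contract_match[OF \<Phi>])
    show "contract l r t (insert w Q) [] = replace_at (contract l r t Q []) w
        (tsubst r (\<lambda>x. contract l r t Q (w @ var_occ l x)))"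
      using w Suc.prems by (intro contract_insert) auto
  qed
  \<comment> \<open>Hence the copying case of \<open>residual\<close> never arises: \<open>w\<close>
    disappears and the others stay where they are.\<close>
  have res: "residuals ((\<lambda>w. (w, (l, r))) ` P) ?\<Delta> = (\<lambda>w. (w, (l, r))) ` (P - {w})"
    using nostrict by (auto simp: residuals_def residual_def)
  have dev: "complete_dev ar X ((\<lambda>w. (w, (l, r))) ` (P - {w})) (contract l r t (insert w Q) [])
      (contract l r t (P - {w} \<union> insert w Q) [])"
  proof (rule Suc.hyps(1))
    show "k = card (P - {w})" using Suc.hyps(2) Suc.prems(1) w(1) by simp
  qed (use Suc.prems w(1) nostrict in auto)
  have "P - {w} \<union> insert w Q = P \<union> Q" using w(1) by auto
  then show ?case using dev_step[OF _ red, of "(\<lambda>w. (w, (l, r))) ` P"] dev w(1)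
    by (simp add: res)
qed

section \<open>Infinite sets of redexes: approximation by cutting\<close>

lemma contract_mono:
  assumes t: "t1 \<subseteq>\<^sub>m t2" and P: "P1 \<subseteq> P2" "P1 \<subseteq> dom t1"
    and new: "\<And>v u. v \<in> P2 - P1 \<Longrightarrow> t1 (v @ u) = None"
  shows "contract l r t1 P1 v \<subseteq>\<^sub>m contract l r t2 P2 v"
proof -
  obtain f where f: "r [] = Some (Inl f)" using r_root by blast
  have "contract l r t1 P1 v w \<noteq> None \<longrightarrow> contract l r t1 P1 v w = contract l r t2 P2 v w" for w
  proof (induction w arbitrary: v rule: length_induct)
    case (1 w)
    \<comment> \<open>At an additional redex \<open>t1\<close> is undefined, so its contraction is
      empty there and lies below anything.\<close>
    consider "v \<in> P1" | "v \<in> P2 - P1" | "v \<notin> P2" by blast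
    then show ?case
    proof cases
      case 1
      let ?\<sigma>1 = "\<lambda>x. contract l r t1 P1 (v @ var_occ l x)"
      let ?\<sigma>2 = "\<lambda>x. contract l r t2 P2 (v @ var_occ l x)"
      have "tsubst r ?\<sigma>1 w \<noteq> None \<longrightarrow> tsubst r ?\<sigma>1 w = tsubst r ?\<sigma>2 w"
        \<comment> \<open>The relation is the definedness order at one occurrence.\<close>
        by (rule tsubst_rel_strict[of r f "\<lambda>a b. a \<noteq> None \<longrightarrow> a = b"]) (use f "1.IH" in auto)
      then show ?thesis using 1 P(1) by (subst (1 2 3) contract_redex) auto
    next
      case 2
      then show ?thesis using contract_bottom[OF new P(2)] by (simp add: bottom_term_def)
    next
      case 3
      then have "v \<notin> P1" using P(1) by blast
      show ?thesis
      proof (cases w)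
        case Nil
        then show ?thesis using t 3 \<open>v \<notin> P1\<close> by (auto simp: contract_Nil map_le_def)
      next
        case (Cons j u)
        then show ?thesis using "1.IH" 3 \<open>v \<notin> P1\<close> by (auto simp: contract_Cons)
      qed
    qed
  qed
  then show ?thesis by (auto simp: map_le_def)
qed

abbreviation "deep \<Phi> i \<equiv> {w \<in> \<Phi>. i \<le> length w}"
abbreviation "shallow \<Phi> i \<equiv> {w \<in> \<Phi>. length w < i}"

text \<open>
  Following \<open>w\<close> from position \<open>v\<close> visits no position of \<open>t\<close> deeper than \<open>length v + M * length w\<close>:
  each symbol consumed passes through at most one redex, which deepens the position by at most \<open>M\<close>.
\<close>

lemma contract_cut:
  assumes M: "\<And>x. x \<in> term_vars r \<Longrightarrow> length (var_occ l x) \<le> M" "0 < M"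
    and "length v + M * length w < i"
  shows "contract l r (cut_at (deep \<Phi> i) t) (shallow \<Phi> i) v w = contract l r t \<Phi> v w"
  using assms(3)
proof (induction w arbitrary: v rule: length_induct)
  case (1 w)
  show ?case
  proof (cases "v \<in> \<Phi>")
    case True
    then have "v \<in> shallow \<Phi> i" using 1(2) by simp
    have "tsubst r (\<lambda>x. contract l r (cut_at (deep \<Phi> i) t) (shallow \<Phi> i) (v @ var_occ l x)) w =
        tsubst r (\<lambda>x. contract l r t \<Phi> (v @ var_occ l x)) w"
    proof (rule tsubst_rhs_cong)
      fix x :: 'l and u :: "nat list" assume x: "x \<in> term_vars r" and u: "length u < length w"
      \<comment> \<open>The symbol consumed by \<open>r\<close> releases \<open>M\<close> units of
        the depth budget, which pay for the at most \<open>M\<close> symbols of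
        \<open>var_occ l x\<close>.\<close>
      have "M * Suc (length u) \<le> M * length w" using u by (intro mult_le_mono2) simp
      then have "length (v @ var_occ l x) + M * length u < i" using M(1)[OF x] 1(2) by simp
      then show "contract l r (cut_at (deep \<Phi> i) t) (shallow \<Phi> i) (v @ var_occ l x) u =
          contract l r t \<Phi> (v @ var_occ l x) u" using 1(1) u by blast
    qed
    then show ?thesis by (simp only: contract_redex[OF True] contract_redex[OF \<open>v \<in> shallow \<Phi> i\<close>])
  next
    case False
    then have v: "v \<notin> shallow \<Phi> i" by simp
    show ?thesis
    proof (cases w)
      case Nil
      have "\<not> prefix u v" if "u \<in> deep \<Phi> i" for u
        using that 1(2) Nil by (auto dest: prefix_length_le)
      then show ?thesis using Nil v False by (auto simp: contract_Nil cut_at_def)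
    next
      case (Cons j u)
      then show ?thesis using v False 1 M(2) by (simp add: contract_Cons)
    qed
  qed
qed

text \<open>The cut positions are themselves redexes of \<open>\<Phi>\<close>, so a cut through the
  left-hand side of a shallow redex would be an overlap.\<close>

lemma redex_occs_cut:
  assumes \<Phi>: "redex_occs ar X l t \<Phi>"
  shows "redex_occs ar X l (cut_at (deep \<Phi> i) t) (shallow \<Phi> i)"
  unfolding redex_occs_def
proof (intro conjI ballI allI impI)
  show "cut_at (deep \<Phi> i) t \<in> CT ar X" using \<Phi> by (intro cut_at_CT) (auto simp: redex_occs_def)
  fix w z f assume w: "w \<in> shallow \<Phi> i" and z: "l z = Some (Inl f)"
  have "\<not> prefix u (w @ z)" if u: "u \<in> deep \<Phi> i" for u
  proof
    assume "prefix u (w @ z)"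
    moreover have "\<not> prefix u w" using u w by (auto dest!: prefix_length_le)
    ultimately obtain z' where z': "u = w @ z'" "prefix z' z" by (auto simp: prefix_append)
    then have "z' \<noteq> []" using u w by auto
    obtain z'' where "z = z' @ z''" using z'(2) by (auto simp: prefix_def)
    then have "\<exists>f. l z' = Some (Inl f)"
      using z CT_appendD[OF l_CT, of z' z''] by (cases "z'' = []") auto
    then show False using \<Phi> z'(1) \<open>z' \<noteq> []\<close> u w unfolding redex_occs_def by blast
  qed
  then show "cut_at (deep \<Phi> i) t (w @ z) = Some (Inl f)"
    using \<Phi> w z unfolding redex_occs_def cut_at_def by auto
  show "w @ z \<notin> shallow \<Phi> i" if "z \<noteq> []" using \<Phi> w z that unfolding redex_occs_def by blast
qed

text \<open>The finiteness hypothesis makes each approximant carry only finitely many redexes, as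
  the infinite case of \<open>par_red\<close> demands.\<close>

theorem par_red_contract:
  assumes \<Phi>: "redex_occs ar X l t \<Phi>" and fin: "\<And>i. finite (shallow \<Phi> i)"
  shows "par_red ar X t ((\<lambda>w. (w, (l, r))) ` \<Phi>) (contract l r t \<Phi> [])"
proof -
  let ?red = "\<lambda>w. (w, (l, r))"
  have t: "t \<in> CT ar X" using \<Phi> by (simp add: redex_occs_def)
  have fpr: "finite_par_red ar X t' (?red ` P) (contract l r t' P [])"
    if "redex_occs ar X l t' P" "finite P" for t' P
    using complete_dev_contract[OF that(1,2), of "{}"] redex_occs_is_redex[OF that(1)] that(2)
    by (auto simp: finite_par_red_def parallel_redex_def contract_empty subterm_at_def
        intro: countable_finite)
  have par: "parallel_redex ar X t (?red ` \<Phi>)"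
    using redex_occs_is_redex[OF \<Phi>] by (auto simp: parallel_redex_def)
  show ?thesis
  proof (cases "finite \<Phi>")
    case True
    then show ?thesis using fpr[OF \<Phi>] par t by (simp add: par_red_def)
  next
    case False
    then have inf: "infinite (?red ` \<Phi>)" by (auto dest!: finite_imageD simp: inj_on_def)
    define T where "T i = cut_at (deep \<Phi> i) t" for i
    define D where "D i = contract l r (T i) (shallow \<Phi> i) []" for i
    have occs: "redex_occs ar X l (T i) (shallow \<Phi> i)" for i
      unfolding T_def using redex_occs_cut[OF \<Phi>] .
    have T_CT: "T i \<in> CT ar X" for i using occs by (simp add: redex_occs_def)
    have T_None: "T i (w @ u) = None" if "w \<in> deep \<Phi> i" for i w u
      using that by (auto simp: T_def cut_at_def)
    have T_le: "T i \<subseteq>\<^sub>m t" "T i \<subseteq>\<^sub>m T (Suc i)" for i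
      by (force simp: T_def cut_at_def map_le_def split: if_splits)+
    \<comment> \<open>A deep redex has lost its root in \<open>T i\<close>, whereas every instance
      of \<open>l\<close> has one.\<close>
    have redexes: "{\<Delta> \<in> ?red ` \<Phi>. is_redex ar X (T i) \<Delta>} = ?red ` shallow \<Phi> i" for i
    proof -
      have "\<not> is_redex ar X (T i) (?red w)" if "w \<in> deep \<Phi> i" for w
      proof
        assume "is_redex ar X (T i) (?red w)"
        then obtain \<sigma> where "subterm_at (T i) w = tsubst l \<sigma>" by (auto simp: is_redex_def)
        then have "T i (w @ []) = tsubst l \<sigma> []" unfolding subterm_at_def by metis
        then show False using T_None[OF that, of "[]"] l_root by auto
      qed
      then have "is_redex ar X (T i) (?red w) \<longleftrightarrow> length w < i" if "w \<in> \<Phi>" for w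
        using redex_occs_is_redex[OF occs, of w i] that by (cases "length w < i") auto
      then show ?thesis by auto
    qed
    obtain M where M: "\<And>x. x \<in> term_vars r \<Longrightarrow> length (var_occ l x) \<le> M" "0 < M"
    proof
      \<comment> \<open>The \<open>Suc\<close> makes the bound positive, so that \<open>M\<close>
        also covers descending by one symbol outside a redex.\<close>
      show "length (var_occ l x) \<le> Suc (Max (length ` dom l))" if "x \<in> term_vars r" for x
        using var_occ[of x] that vars l_finite by (intro le_SucI Max_ge) auto
    qed simp
    have D_CT: "D i \<in> CT ar X" for i
      unfolding D_def using T_CT redex_occs_dom[OF occs] by (rule contract_CT)
    have D_le: "D i \<subseteq>\<^sub>m contract l r t \<Phi> []" "D i \<subseteq>\<^sub>m D (Suc i)" for i
      unfolding D_def
      by (rule contract_mono[OF _ _ redex_occs_dom[OF occs]]; (rule T_le T_None)?; auto)+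
    have "term_lub ar X T t"
      using t T_le(1)
    proof (rule term_lubI)
      fix w assume "w \<in> dom t"
      \<comment> \<open>Here every cut position is longer than \<open>w\<close>, hence not a prefix
        of it.\<close>
      then have "w \<in> dom (T (Suc (length w)))"
        by (fastforce simp: T_def cut_at_def dest: prefix_length_le)
      then show "\<exists>i. w \<in> dom (T i)" ..
    qed
    moreover have "term_lub ar X D (contract l r t \<Phi> [])"
    proof (rule term_lubI)
      show "contract l r t \<Phi> [] \<in> CT ar X" using t redex_occs_dom[OF \<Phi>] by (rule contract_CT)
      show "D i \<subseteq>\<^sub>m contract l r t \<Phi> []" for i by (rule D_le)
      fix w assume "w \<in> dom (contract l r t \<Phi> [])"
      then have "w \<in> dom (D (Suc (M * length w)))"
        using contract_cut[OF M, of "[]" w "Suc (M * length w)" \<Phi> t] by (simp add: D_def T_def dom_def)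
      then show "\<exists>i. w \<in> dom (D i)" ..
    qed
    moreover have "\<forall>(w, R)\<in>?red ` \<Phi>. is_redex ar X (T i) (w, R) \<or> T i w = None" for i
    proof -
      have "is_redex ar X (T i) (?red w) \<or> T i w = None" if "w \<in> \<Phi>" for w
        using redex_occs_is_redex[OF occs, of w i] T_None[of w i "[]"] that
        by (cases "length w < i") auto
      then show ?thesis by auto
    qed
    moreover have "finite_par_red ar X (T i) {\<Delta> \<in> ?red ` \<Phi>. is_redex ar X (T i) \<Delta>} (D i)" for i
      unfolding D_def redexes using fpr[OF occs fin] .
    moreover have "term_chain ar X T" "term_chain ar X D"
      using T_CT T_le D_CT D_le by (simp_all add: term_chain_def)
    ultimately show ?thesis
      using t par inf unfolding par_red_def by (simp only: if_False) blast
  qed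
qed

end

section \<open>Unravelings\<close>

text \<open>An occurrence determines its path, so the quantified path and the definite description
  in \<open>unravel\<close> can be replaced by a recursive function.\<close>

fun node_at :: "('n, 'f) tgraph \<Rightarrow> 'n \<Rightarrow> nat list \<Rightarrow> 'n option" where
  "node_at G n [] = (if n \<in> nodes G then Some n else None)"
| "node_at G n (j # w) = (if n \<in> nodes G then
     (case gsucc G n of None \<Rightarrow> None
      | Some ss \<Rightarrow> if 0 < j \<and> j \<le> length ss then node_at G (ss ! (j - 1)) w else None) else None)"

lemma node_at_iff_path: "node_at G n w = Some m \<longleftrightarrow> (\<exists>\<pi>. is_path G n \<pi> m \<and> path_occ \<pi> = w)"
proof (induction w arbitrary: n)
  case Nil
  show ?case by (auto simp: path_occ_def)
next
  case (Cons j w)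
  have "(\<exists>\<pi>. is_path G n \<pi> m \<and> path_occ \<pi> = j # w) \<longleftrightarrow>
      (\<exists>n' \<pi>. is_path G n ((j, n') # \<pi>) m \<and> path_occ \<pi> = w)"
    by (fastforce simp: path_occ_def)
  also have "\<dots> \<longleftrightarrow> n \<in> nodes G \<and>
      (\<exists>ss. gsucc G n = Some ss \<and> 0 < j \<and> j \<le> length ss \<and> node_at G (ss ! (j - 1)) w = Some m)"
    unfolding is_path.simps Cons by blast
  finally show ?case by (auto split: option.splits)
qed

lemma unravel_eq:
  "unravel G n w = map_option (\<lambda>m. case glab G m of None \<Rightarrow> Inr m | Some f \<Rightarrow> Inl f) (node_at G n w)"
proof (cases "node_at G n w")
  case None
  then have "\<not> (\<exists>\<pi> m. is_path G n \<pi> m \<and> path_occ \<pi> = w)" by (metis node_at_iff_path option.distinct(1))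
  then have "unravel G n w = None" unfolding unravel_def by (rule if_not_P)
  then show ?thesis using None by simp
next
  case (Some m)
  then have "\<exists>\<pi> m. is_path G n \<pi> m \<and> path_occ \<pi> = w" by (metis node_at_iff_path)
  moreover have "(THE m. \<exists>\<pi>. is_path G n \<pi> m \<and> path_occ \<pi> = w) = m"
    using Some by (auto simp flip: node_at_iff_path)
  ultimately show ?thesis using Some by (simp add: unravel_def split: option.split)
qed

lemma node_at_append: "node_at G n (v @ w) = Option.bind (node_at G n v) (\<lambda>m. node_at G m w)"
  by (induction v arbitrary: n) (cases w; auto split: option.split)+

lemma node_at_nodes: "node_at G n w = Some m \<Longrightarrow> m \<in> nodes G"
  by (induction w arbitrary: n) (auto split: option.splits if_splits)

lemma subterm_at_unravel_succ:
  assumes "n \<in> nodes G" "gsucc G n = Some ss"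
  shows "subterm_at (unravel G n) [j] =
           (if 0 < j \<and> j \<le> length ss then unravel G (ss ! (j - 1)) else bottom_term)"
  using assms by (simp add: subterm_at_def unravel_eq fun_eq_iff bottom_term_def)

lemma node_at_morphism:
  assumes "graph_morphism G H f" "\<And>n. gsucc G n = None \<longleftrightarrow> glab G n = None"
    and "node_at G n w = Some m"
  shows "node_at H (f n) w = Some (f m)"
  using assms(3)
proof (induction w arbitrary: n)
  case Nil
  then show ?case using assms(1) by (auto simp: graph_morphism_def split: if_splits)
next
  case (Cons j w)
  then obtain ss where ss: "n \<in> nodes G" "gsucc G n = Some ss" "0 < j" "j \<le> length ss"
      "node_at G (ss ! (j - 1)) w = Some m"
    by (auto split: option.splits if_splits)
  then have "f n \<in> nodes H" "gsucc H (f n) = Some (map f ss)"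
    using assms(1) assms(2)[of n] by (auto simp: graph_morphism_def)
  then show ?case using ss Cons.IH by auto
qed

section \<open>Unravelings of one finite term graph\<close>

context
  fixes ar :: "'f \<Rightarrow> nat" and G :: "('n, 'f) tgraph"
  assumes G: "term_graph ar G"
begin

lemma gsucc_None_iff: "gsucc G n = None \<longleftrightarrow> glab G n = None"
  using G unfolding term_graph_def by (metis domIff)

lemma glab_nodes: "glab G n = Some f \<Longrightarrow> n \<in> nodes G"
  using G by (auto simp: term_graph_def)

lemma gsucc_props:
  assumes "gsucc G n = Some ss"
  shows "set ss \<subseteq> nodes G" "glab G n = Some f \<Longrightarrow> length ss = ar f"
proof -
  obtain f' where "glab G n = Some f'" using assms gsucc_None_iff[of n] by auto
  then show "set ss \<subseteq> nodes G" using G assms by (auto simp: term_graph_def)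
  show "glab G n = Some f \<Longrightarrow> length ss = ar f" using G assms by (auto simp: term_graph_def)
qed

lemma gsucc_nth: "gsucc G n = Some ss \<Longrightarrow> 0 < j \<Longrightarrow> j \<le> length ss \<Longrightarrow> ss ! (j - 1) \<in> nodes G"
  using gsucc_props(1)[of n ss] by (auto simp: subset_iff)

lemma node_at_snoc:
  "node_at G n (w @ [i]) \<noteq> None \<longleftrightarrow>
    (\<exists>m f. node_at G n w = Some m \<and> glab G m = Some f \<and> 0 < i \<and> i \<le> ar f)"
proof (cases "node_at G n w")
  case None
  then show ?thesis by (simp add: node_at_append)
next
  case (Some m)
  show ?thesis
  proof (cases "gsucc G m")
    case None
    then show ?thesis using Some gsucc_None_iff[of m] by (simp add: node_at_append)
  next
    case (Some ss)
    then obtain f where "glab G m = Some f" using gsucc_None_iff[of m] by auto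
    then show ?thesis
      using Some \<open>node_at G n w = Some m\<close> gsucc_props[OF Some] gsucc_nth[OF Some] node_at_nodes
      by (auto simp: node_at_append)
  qed
qed

lemma unravel_CT: "unravel G n \<in> CT ar (var_nodes G)"
proof -
  have "\<exists>f. unravel G n w = Some (Inl f) \<and> 0 < i \<and> i \<le> ar f" if "unravel G n (w @ [i]) \<noteq> None" for w i
    using that node_at_snoc[of n w i] by (auto simp: unravel_eq)
  moreover have "term_vars (unravel G n) \<subseteq> var_nodes G"
    using node_at_nodes
    by (fastforce simp: term_vars_def unravel_eq var_nodes_def split: option.splits)
  ultimately show ?thesis unfolding CT_def by blast
qed

lemma total_term_unravel: "total_term ar (unravel G n)"
  unfolding total_term_def using node_at_snoc[of n]
  by (fastforce simp: unravel_eq dom_def split: option.splits)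

text \<open>The image of a variable node may be labelled, in which case \<open>H\<close> continues
  below it; the substitution supplies this continuation.\<close>

lemma unravel_morphism:
  assumes H: "term_graph ar H" and f: "graph_morphism G H f" and "n \<in> nodes G"
  shows "unravel H (f n) = tsubst (unravel G n) (\<lambda>x. unravel H (f x))"
proof
  fix w show "unravel H (f n) w = tsubst (unravel G n) (\<lambda>x. unravel H (f x)) w"
    using assms(3)
  proof (induction w arbitrary: n)
    case Nil
    then show ?case using f by (auto simp: unravel_eq graph_morphism_def split: option.split)
  next
    case (Cons j w)
    show ?case
    proof (cases "glab G n")
      case None
      then show ?thesis using Cons.prems by (simp add: unravel_eq)
    next
      case (Some a)
      then obtain ss where ss: "gsucc G n = Some ss" using gsucc_None_iff[of n] by auto
      have fn: "f n \<in> nodes H" "gsucc H (f n) = Some (map f ss)"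
        using f Cons.prems Some ss by (auto simp: graph_morphism_def)
      have "unravel H (f n) (j # w) = subterm_at (unravel H (f n)) [j] w"
        by (simp add: subterm_at_def)
      also have "\<dots> = (if 0 < j \<and> j \<le> length ss then unravel H (f (ss ! (j - 1))) w else None)"
        unfolding subterm_at_unravel_succ[OF fn] by (auto simp: bottom_term_def)
      also have "\<dots> = tsubst (subterm_at (unravel G n) [j]) (\<lambda>x. unravel H (f x)) w"
        using Cons.IH gsucc_nth[OF ss] unfolding subterm_at_unravel_succ[OF Cons.prems ss]
        by (simp add: tsubst_bottom) (simp add: bottom_term_def)
      also have "\<dots> = tsubst (unravel G n) (\<lambda>x. unravel H (f x)) (j # w)"
        using Some Cons.prems by (simp add: unravel_eq)
      finally show ?thesis .
    qed
  qed
qed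

text \<open>Finitely many nodes bound the arities, so unravelings branch boundedly even when
  infinite.\<close>

lemma finite_occs_length: "finite {w. node_at G n w \<noteq> None \<and> length w < i}"
proof -
  \<comment> \<open>Inserting \<open>0\<close> covers graphs without labelled nodes.\<close>
  define M where "M = Max (insert 0 (ar ` (\<Union>n\<in>nodes G. set_option (glab G n))))"
  have "finite (ar ` (\<Union>n\<in>nodes G. set_option (glab G n)))"
    using G by (auto simp: term_graph_def)
  then have M: "ar f \<le> M" if "glab G m = Some f" for m f
    unfolding M_def using that glab_nodes by (intro Max_ge) force+
  have "set w \<subseteq> {..M}" if "node_at G n w \<noteq> None" for w
    using that
  proof (induction w rule: rev_induct)
    case (snoc i w)
    then obtain m f where "node_at G n w = Some m" "glab G m = Some f" "i \<le> ar f"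
      using node_at_snoc[of n w i] by auto
    then show ?case using snoc M[of m f] by auto
  qed simp
  then have "{w. node_at G n w \<noteq> None \<and> length w < i} \<subseteq> {w. set w \<subseteq> {..M} \<and> length w \<le> i}" by auto
  then show ?thesis using finite_lists_length_le[of "{..M}" i] finite_subset by blast
qed

text \<open>For the left-hand side of a rule this is the source of left-linearity.\<close>

lemma tree_node_at_inj:
  assumes "is_tree G n" "node_at G n v = Some m" "node_at G n w = Some m"
  shows "v = w"
proof -
  obtain \<pi> \<rho> where "is_path G n \<pi> m" "path_occ \<pi> = v" "is_path G n \<rho> m" "path_occ \<rho> = w"
    using assms(2,3) unfolding node_at_iff_path by blast
  then show ?thesis using assms(1) node_at_nodes[OF assms(2)] unfolding is_tree_def by blast
qed

lemma tree_node_at_surj: "is_tree G n \<Longrightarrow> m \<in> nodes G \<Longrightarrow> \<exists>w. node_at G n w = Some m"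
  unfolding is_tree_def node_at_iff_path by blast

lemma finite_dom_unravel_tree:
  assumes "is_tree G n"
  shows "finite (dom (unravel G n))"
proof (rule inj_on_finite)
  show "inj_on (\<lambda>w. the (node_at G n w)) (dom (unravel G n))"
    using tree_node_at_inj[OF assms] by (auto simp: inj_on_def unravel_eq)
  show "(\<lambda>w. the (node_at G n w)) ` dom (unravel G n) \<subseteq> nodes G"
    using node_at_nodes by (fastforce simp: unravel_eq)
  show "finite (nodes G)" using G by (simp add: term_graph_def)
qed

end

section \<open>Evaluation steps\<close>

lemma CT_mono: "X \<subseteq> Y \<Longrightarrow> t \<in> CT ar X \<Longrightarrow> t \<in> CT ar Y"
  by (auto simp: CT_def)

lemma unravel_var_node:
  assumes "n \<in> nodes G" "glab G n = None" "gsucc G n = None"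
  shows "unravel G n = var_term n"
proof
  show "unravel G n w = var_term n w" for w
    using assms by (cases w) (simp_all add: unravel_eq var_term_def)
qed

lemma term_vars_unravel_tree:
  assumes "term_graph ar G" "is_tree G n"
  shows "term_vars (unravel G n) = var_nodes G"
proof
  show "term_vars (unravel G n) \<subseteq> var_nodes G" using unravel_CT[OF assms(1)] by (auto simp: CT_def)
  show "var_nodes G \<subseteq> term_vars (unravel G n)"
  proof
    fix x assume x: "x \<in> var_nodes G"
    then obtain w where "node_at G n w = Some x"
      using tree_node_at_surj[OF assms, of x] by (auto simp: var_nodes_def)
    then have "unravel G n w = Some (Inr x)" using x by (simp add: unravel_eq var_nodes_def)
    then show "x \<in> term_vars (unravel G n)" by (rule term_varsI)
  qed
qed

lemma is_pushoutD:
  assumes "is_pushout ar C A B P f g f' g'"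
  shows "term_graph ar B \<and> term_graph ar P \<and> graph_morphism C B g \<and> graph_morphism A P f' \<and>
    graph_morphism B P g' \<and> agree_on (nodes C) (f' \<circ> f) (g' \<circ> g)"
  using assms unfolding is_pushout_def by (elim conjE) (intro conjI; assumption)

locale evaluation_step =
  fixes ar :: "'f \<Rightarrow> nat"
    and p :: "('l, 'r, 'f) eval_rule"
    and G D :: "('n, 'f) tgraph" and H :: "('m, 'f) tgraph"
    and g k :: "'l \<Rightarrow> 'n" and h :: "'r \<Rightarrow> 'm" and d :: "'n \<Rightarrow> 'n" and b :: "'n \<Rightarrow> 'm"
  assumes p: "evaluation_rule ar p"
    and G: "term_graph ar G"
    and g: "graph_morphism (lhs p) G g"
    and D_eq: "D = unlabel G (g (rule_root p))"
    and d: "\<forall>x\<in>nodes D. d x = x"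
    and derivation: "direct_derivation ar p G D H g k h d b"
begin

abbreviation "L \<equiv> lhs p"
abbreviation "K \<equiv> itf p"
abbreviation "R \<equiv> rhs p"
abbreviation "\<rho> \<equiv> rule_root p"
abbreviation "q \<equiv> g \<rho>"
abbreviation "l \<equiv> fst (unravel_rule p)"
abbreviation "r \<equiv> snd (unravel_rule p)"

lemma L: "term_graph ar L" and K: "term_graph ar K" and R: "term_graph ar R"
  and rmor: "graph_morphism K R (rmor p)" "inj_on (rmor p) (nodes K)"
  and tree: "is_tree L \<rho>" and K_eq: "K = unlabel L \<rho>"
  and lmor: "x \<in> nodes K \<Longrightarrow> lmor p x = x"
  and rmor_vars: "bij_betw (rmor p) (var_nodes L) (var_nodes R)"
  using p by (auto simp: evaluation_rule_def)

lemma nodes_K: "nodes K = nodes L" and nodes_D: "nodes D = nodes G"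
  by (simp_all add: K_eq D_eq unlabel_def)

lemma D: "term_graph ar D" and H: "term_graph ar H"
  and k: "graph_morphism K D k" and h: "graph_morphism R H h" and b: "graph_morphism D H b"
  and left_commutes: "agree_on (nodes K) (g \<circ> lmor p) (d \<circ> k)"
  and right_commutes: "agree_on (nodes K) (h \<circ> rmor p) (b \<circ> k)"
  using derivation by (auto simp: direct_derivation_def dest!: is_pushoutD)

lemma right_square: "x \<in> nodes K \<Longrightarrow> h (rmor p x) = b (k x)"
  using right_commutes by (simp add: agree_on_def)

lemma root_node: "\<rho> \<in> nodes L"
  using tree by (simp add: is_tree_def)

text \<open>\<open>d\<close> and \<open>lmor p\<close> act as inclusions, so commutativity of the
  left square forces this.\<close>

lemma k_eq: "x \<in> nodes L \<Longrightarrow> k x = g x"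
proof -
  assume x: "x \<in> nodes L"
  then have "g (lmor p x) = d (k x)" using left_commutes nodes_K by (simp add: agree_on_def)
  moreover have "k x \<in> nodes D" using k x nodes_K by (auto simp: graph_morphism_def)
  ultimately show ?thesis using d lmor x nodes_K by simp
qed

lemma root_labelled: "\<exists>f. glab L \<rho> = Some f"
proof (rule ccontr)
  assume "\<nexists>f. glab L \<rho> = Some f"
  then have None: "glab L \<rho> = None" "gsucc L \<rho> = None"
    using gsucc_None_iff[OF L] by auto
  have "m = \<rho>" if m: "m \<in> nodes L" for m
  proof -
    obtain w where "node_at L \<rho> w = Some m" using tree_node_at_surj[OF L tree m] ..
    then show ?thesis using None root_node by (cases w) auto
  qed
  then have "nodes L = {\<rho>}" using root_node by blast
  then show False using p None by (simp add: evaluation_rule_def)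
qed

lemma q_labelled: "q \<notin> var_nodes G"
  using root_labelled root_node g by (auto simp: graph_morphism_def var_nodes_def)

text \<open>
  This is where the existence of the context graph excludes overlaps: \<open>k\<close> must preserve the labels
  of the inner nodes of \<open>L\<close>, but \<open>q\<close> has lost its label in \<open>D\<close>.
\<close>

lemma inner_node_not_redex:
  assumes "glab L x = Some f" "x \<noteq> \<rho>"
  shows "g x \<noteq> q"
proof -
  have x: "x \<in> nodes L" "glab K x = Some f"
    using assms glab_nodes[OF L] by (auto simp: K_eq unlabel_def)
  then have "glab D (k x) = Some f" using k nodes_K by (auto simp: graph_morphism_def)
  then show ?thesis using k_eq[OF x(1)] by (auto simp: D_eq unlabel_def)
qed

text \<open>Since \<open>rmor p\<close> is injective, evaluation rules are never collapsing.\<close>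

lemma rhs_root: "rmor p \<rho> \<in> nodes R" "\<exists>f. glab R (rmor p \<rho>) = Some f"
proof -
  show nodes: "rmor p \<rho> \<in> nodes R"
    using rmor(1) root_node nodes_K by (auto simp: graph_morphism_def)
  show "\<exists>f. glab R (rmor p \<rho>) = Some f"
  proof (rule ccontr)
    assume "\<nexists>f. glab R (rmor p \<rho>) = Some f"
    then have "rmor p \<rho> \<in> var_nodes R" using nodes by (auto simp: var_nodes_def)
    then obtain x where "x \<in> var_nodes L" "rmor p x = rmor p \<rho>"
      using rmor_vars by (metis bij_betw_imp_surj_on imageE)
    then show False
      using root_labelled root_node rmor(2) nodes_K by (auto simp: var_nodes_def dest: inj_onD)
  qed
qed

lemma unravel_rule_eq:
  "l = unravel L \<rho>"
  "r = tsubst (unravel R (rmor p \<rho>)) (\<lambda>x. var_term (inv_into (var_nodes L) (rmor p) x))"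
  by (simp_all add: unravel_rule_def)

lemma term_vars_l: "term_vars l = var_nodes L"
  using term_vars_unravel_tree[OF L tree] by (simp add: unravel_rule_eq)

lemma term_vars_rhs: "term_vars (unravel R (rmor p \<rho>)) \<subseteq> var_nodes R"
  using unravel_CT[OF R] by (auto simp: CT_def)

lemma l_varD: "l w = Some (Inr x) \<Longrightarrow> node_at L \<rho> w = Some x"
  by (auto simp: unravel_rule_eq unravel_eq split: option.splits)

lemma l_funD: "l w = Some (Inl f) \<Longrightarrow> \<exists>m. node_at L \<rho> w = Some m \<and> glab L m = Some f"
  by (auto simp: unravel_rule_eq unravel_eq split: option.splits)

sublocale orthogonal_rule ar l r
proof
  obtain f where f: "glab L \<rho> = Some f" using root_labelled by blast
  then have root: "l [] = Some (Inl f)" using root_node by (simp add: unravel_rule_eq unravel_eq)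
  then show "\<exists>f. l [] = Some (Inl f)" ..
  obtain f' where "glab R (rmor p \<rho>) = Some f'" using rhs_root by blast
  then have "r [] = Some (Inl f')" using rhs_root by (simp add: unravel_rule_eq unravel_eq)
  then show "\<exists>f. r [] = Some (Inl f)" ..
  show "w = w'" if "l w = Some (Inr x)" "l w' = Some (Inr x)" for w w' x
    using tree_node_at_inj[OF L tree] l_varD that by blast
  have "x \<in> var_nodes L" if x: "x \<in> term_vars r" for x
  proof -
    obtain y where "y \<in> term_vars (unravel R (rmor p \<rho>))"
        and "x \<in> term_vars (var_term (inv_into (var_nodes L) (rmor p) y) :: ('f, 'l) pterm)"
      using x term_vars_tsubst unfolding unravel_rule_eq by fast
    then have "y \<in> var_nodes R" "x = inv_into (var_nodes L) (rmor p) y"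
      using term_vars_rhs by (auto simp: term_vars_def var_term_def split: if_splits)
    then show ?thesis using rmor_vars by (metis bij_betw_imp_surj_on inv_into_into)
  qed
  moreover have "l \<in> CT ar UNIV" "total_term ar l" "finite (dom l)"
    using CT_mono[OF _ unravel_CT[OF L]] total_term_unravel[OF L] finite_dom_unravel_tree[OF L tree]
    by (auto simp: unravel_rule_eq)
  moreover have "r \<in> CT ar UNIV" unfolding unravel_rule_eq
    by (intro tsubst_CT[OF unravel_CT[OF R]] var_term_CT) simp
  moreover have "total_term ar r" unfolding unravel_rule_eq
    by (intro total_term_tsubst total_term_unravel[OF R] total_term_var_term)
      (simp add: var_term_def)
  moreover have "\<not> is_var_term l" using root by (auto simp: is_var_term_def var_term_def)
  ultimately show "term_rule ar (l, r)"
    using term_vars_l by (auto simp: term_rule_def finite_term_def)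
qed

section \<open>The redexes of the unraveling and the injectivity of the track function\<close>

definition occs :: "'n \<Rightarrow> nat list set" where
  "occs n = {w. node_at G n w = Some q}"

lemma node_at_below_redex:
  assumes "w \<in> occs n" "node_at L \<rho> z = Some m"
  shows "node_at G n (w @ z) = Some (g m)"
  using assms node_at_morphism[OF g gsucc_None_iff[OF L]] by (simp add: occs_def node_at_append)

text \<open>Paths of \<open>L\<close> are carried along \<open>g\<close> with their labels, which
  gives the match at every path to \<open>q\<close>; \<open>inner_node_not_redex\<close> gives the
  separation.\<close>

lemma redex_occs_unravel: "redex_occs ar (var_nodes G) l (unravel G n) (occs n)"
  unfolding redex_occs_def
proof (intro conjI ballI allI impI)
  show "unravel G n \<in> CT ar (var_nodes G)" by (rule unravel_CT[OF G])
  fix w z f assume w: "w \<in> occs n" and "l z = Some (Inl f)"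
  then obtain m where m: "node_at L \<rho> z = Some m" "glab L m = Some f" using l_funD by blast
  note at = node_at_below_redex[OF w m(1)]
  have "glab G (g m) = Some f"
    using g m glab_nodes[OF L m(2)] by (auto simp: graph_morphism_def)
  then show "unravel G n (w @ z) = Some (Inl f)" using at by (simp add: unravel_eq)
  show "w @ z \<notin> occs n" if "z \<noteq> []"
  proof -
    \<comment> \<open>In a tree only the empty occurrence leads to the root.\<close>
    have "node_at L \<rho> [] = Some \<rho>" using root_node by simp
    then have "m \<noteq> \<rho>" using tree_node_at_inj[OF L tree] m(1) that by blast
    then show ?thesis using at inner_node_not_redex[OF m(2)] by (simp add: occs_def)
  qed
qed

text \<open>
  A cocone over the right-hand square with the pushout of the underlying sets as node set: it
  separates the nodes of \<open>D\<close> and keeps those from \<open>var_nodes G\<close> unlabelled, so \<open>H\<close> must do the same.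
\<close>

lemma track_var_nodes:
  "inj_on b (nodes G)"
  "x \<in> var_nodes G \<Longrightarrow> glab H (b x) = None"
proof -
  define N where "N = nodes R - rmor p ` nodes K"
  define u :: "'r \<Rightarrow> 'n + 'r" where
    "u y = (if y \<in> rmor p ` nodes K then Inl (k (inv_into (nodes K) (rmor p) y)) else Inr y)" for y
  \<comment> \<open>As \<open>rmor p\<close> is injective, gluing adds the fresh nodes
    \<open>N\<close> without merging nodes of \<open>D\<close>. Only \<open>q\<close> takes its
    label and successors from \<open>R\<close>: it has none in \<open>D\<close>.\<close>
  define Z :: "('n + 'r, 'f) tgraph" where "Z = \<lparr>nodes = Inl ` nodes D \<union> Inr ` N,
    gsucc = case_sum
      (\<lambda>x. if x = q then map_option (map u) (gsucc R (rmor p \<rho>)) else map_option (map Inl) (gsucc D x))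
      (\<lambda>y. if y \<in> N then map_option (map u) (gsucc R y) else None),
    glab = case_sum (\<lambda>x. if x = q then glab R (rmor p \<rho>) else glab D x)
      (\<lambda>y. if y \<in> N then glab R y else None)\<rparr>"
  have u_rmor: "u (rmor p x) = Inl (k x)" if "x \<in> nodes K" for x
    using that rmor(2) by (simp add: u_def)
  have k_nodes: "k x \<in> nodes D" if "x \<in> nodes K" for x
    using k that by (auto simp: graph_morphism_def)
  have u_nodes: "u y \<in> nodes Z" if "y \<in> nodes R" for y
    using that u_rmor k_nodes by (cases "y \<in> rmor p ` nodes K") (auto simp: Z_def N_def u_def)
  have q: "q \<in> nodes D" "glab D q = None" "k \<rho> = q" "\<rho> \<in> nodes K"
    using k_eq[OF root_node] k_nodes[of \<rho>] root_node nodes_K by (auto simp: D_eq unlabel_def)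
  have Z: "term_graph ar Z"
    unfolding term_graph_def
  proof (intro conjI allI impI)
    show "finite (nodes Z)" using D R by (simp add: Z_def N_def term_graph_def)
    have "gsucc Z z = None \<longleftrightarrow> glab Z z = None" for z
      by (simp add: Z_def gsucc_None_iff[OF D] gsucc_None_iff[OF R] split: sum.split)
    then show "dom (gsucc Z) = dom (glab Z)" by (auto simp: dom_def)
    show "dom (glab Z) \<subseteq> nodes Z"
      using q(1) glab_nodes[OF D] by (auto simp: Z_def split: sum.splits if_splits)
    fix z ss f assume z: "gsucc Z z = Some ss \<and> glab Z z = Some f"
    have "set ss \<subseteq> nodes Z \<and> length ss = ar f"
    proof (cases "\<exists>x. z = Inl x \<and> x \<noteq> q")
      case True
      then obtain ss' where "ss = map Inl ss'" "set ss' \<subseteq> nodes D" "length ss' = ar f"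
        using z gsucc_props[OF D] by (fastforce simp: Z_def)
      then show ?thesis by (auto simp: Z_def)
    next
      case False
      then obtain y ss' where "gsucc R y = Some ss'" "glab R y = Some f" "ss = map u ss'"
        using z by (cases z) (auto simp: Z_def split: if_splits)
      then show ?thesis using gsucc_props[OF R] u_nodes by fastforce
    qed
    then show "set ss \<subseteq> nodes Z" "length ss = ar f" by auto
  qed
  have "graph_morphism D Z Inl"
    using q(2) by (auto simp: graph_morphism_def Z_def)
  moreover have "graph_morphism R Z u"
    unfolding graph_morphism_def
  proof (intro conjI ballI impI)
    show "u ` nodes R \<subseteq> nodes Z" using u_nodes by blast
    fix y assume y: "y \<in> nodes R" "glab R y \<noteq> None"
    have "glab Z (u y) = glab R y \<and> gsucc Z (u y) = map_option (map u) (gsucc R y)"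
    proof (cases "y \<in> rmor p ` nodes K")
      case False
      then show ?thesis using y by (simp add: u_def Z_def N_def)
    next
      case True
      then obtain x where x: "x \<in> nodes K" "y = rmor p x" by blast
      show ?thesis
      proof (cases "x = \<rho>")
        case True
        then show ?thesis using x u_rmor q by (simp add: Z_def)
      next
        case False
        \<comment> \<open>\<open>rmor p\<close> sends variables to variables, but \<open>y\<close>
          is labelled.\<close>
        have "x \<notin> var_nodes L"
        proof
          assume "x \<in> var_nodes L"
          then have "y \<in> var_nodes R" using x rmor_vars bij_betwE by fast
          then show False using y by (simp add: var_nodes_def)
        qed
        then have lab: "glab K x \<noteq> None" "glab L x \<noteq> None"
          using x False nodes_K by (auto simp: var_nodes_def K_eq unlabel_def)
        obtain ss where ss: "gsucc K x = Some ss" using lab gsucc_None_iff[OF K, of x] by auto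
        \<comment> \<open>So \<open>Z\<close> takes its data at \<open>k x\<close> from
          \<open>D\<close>, and these agree with \<open>R\<close> because both come from
          \<open>K\<close>.\<close>
        have "k x \<noteq> q" using lab False inner_node_not_redex[of x] k_eq x nodes_K by auto
        moreover have "glab R y = glab K x" "gsucc R y = Some (map (rmor p) ss)"
          using rmor(1) x lab ss by (auto simp: graph_morphism_def)
        moreover have "glab D (k x) = glab K x" "gsucc D (k x) = Some (map k ss)"
          using k x lab ss by (auto simp: graph_morphism_def)
        moreover have "\<forall>s\<in>set ss. u (rmor p s) = Inl (k s)"
          using gsucc_props(1)[OF K ss] u_rmor by auto
        ultimately show ?thesis using u_rmor x by (simp add: Z_def)
      qed
    qed
    then show "glab Z (u y) = glab R y" "gsucc Z (u y) = map_option (map u) (gsucc R y)" by auto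
  qed
  moreover have "agree_on (nodes K) (u \<circ> rmor p) (Inl \<circ> k)"
    using u_rmor by (simp add: agree_on_def)
  moreover have "is_pushout ar K R D H (rmor p) k h b"
    using derivation by (simp add: direct_derivation_def)
  ultimately obtain \<psi> where \<psi>: "graph_morphism H Z \<psi>" "agree_on (nodes D) (\<psi> \<circ> b) Inl"
    using is_pushout_universal[OF _ Z] by blast
  then have \<psi>_b: "\<psi> (b x) = Inl x" if "x \<in> nodes G" for x
    using that nodes_D by (simp add: agree_on_def)
  show "inj_on b (nodes G)"
  proof (rule inj_onI)
    fix x y assume "x \<in> nodes G" "y \<in> nodes G" "b x = b y"
    then show "x = y" by (metis \<psi>_b sum.inject(1))
  qed
  assume x: "x \<in> var_nodes G"
  then have "x \<in> nodes G" "x \<noteq> q" "glab D x = None"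
    using q_labelled by (auto simp: var_nodes_def D_eq unlabel_def)
  \<comment> \<open>A label at \<open>b x\<close> would be preserved by \<open>\<psi>\<close>, but
    its image carries none.\<close>
  then have "glab Z (\<psi> (b x)) = None" using \<psi>_b by (simp add: Z_def)
  moreover have "b x \<in> nodes H" using b x nodes_D by (auto simp: graph_morphism_def var_nodes_def)
  ultimately show "glab H (b x) = None"
    using \<psi>(1) unfolding graph_morphism_def by (cases "glab H (b x)") auto
qed

section \<open>Agreement of the contraction with the unraveling of \<open>H\<close>\<close>

lemma unravel_H_redex:
  "tsubst (unravel H (b q)) \<sigma> = tsubst r (\<lambda>x. tsubst (unravel H (b (g x))) \<sigma>)"
proof -
  let ?inv = "inv_into (var_nodes L) (rmor p)"
  have "b q = h (rmor p \<rho>)" using right_square[of \<rho>] k_eq root_node nodes_K by simp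
  then have "tsubst (unravel H (b q)) \<sigma> =
      tsubst (unravel R (rmor p \<rho>)) (\<lambda>z. tsubst (unravel H (h z)) \<sigma>)"
    using unravel_morphism[OF R H h rhs_root(1)] by (simp add: tsubst_tsubst)
  also have "\<dots> = tsubst (unravel R (rmor p \<rho>)) (\<lambda>z. tsubst (unravel H (b (g (?inv z)))) \<sigma>)"
  proof (rule tsubst_cong)
    \<comment> \<open>A variable of \<open>R\<close> comes from exactly one variable of
      \<open>L\<close>, along which the right square leads back to \<open>G\<close>.\<close>
    fix z assume "z \<in> term_vars (unravel R (rmor p \<rho>))"
    then have "z \<in> rmor p ` var_nodes L" using term_vars_rhs rmor_vars by (auto simp: bij_betw_def)
    then have "?inv z \<in> nodes L" "rmor p (?inv z) = z"
      using inv_into_into[of z "rmor p" "var_nodes L"] by (auto simp: var_nodes_def f_inv_into_f)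
    then have "h z = b (g (?inv z))" using right_square[of "?inv z"] k_eq nodes_K by simp
    then show "tsubst (unravel H (h z)) \<sigma> = tsubst (unravel H (b (g (?inv z)))) \<sigma>" by simp
  qed
  finally show ?thesis by (simp add: unravel_rule_eq tsubst_tsubst tsubst_var)
qed

lemma track_subst_b:
  assumes "y \<in> var_nodes G" "\<forall>x\<in>nodes G. tr x = b x"
  shows "track_subst G tr (b y) = var_term y"
proof -
  have "y' = y" if "y' \<in> var_nodes G" "tr y' = b y" for y'
    using assms that track_var_nodes(1) by (auto simp: var_nodes_def dest: inj_onD)
  moreover have "tr y = b y" using assms by (simp add: var_nodes_def)
  ultimately have "(THE y'. y' \<in> var_nodes G \<and> tr y' = b y) = y" using assms(1) by blast
  then show ?thesis using \<open>tr y = b y\<close> assms(1) by (auto simp: track_subst_def)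
qed

text \<open>Both sides obey the same equations, depending only on whether \<open>m\<close> is
  \<open>q\<close>, a variable node or another labelled node. Generalizing over \<open>v\<close> and
  \<open>m\<close> lets the induction re-enter \<open>G\<close> below a redex.\<close>

lemma contract_unravel:
  assumes tr: "\<forall>x\<in>nodes G. tr x = b x" and "node_at G n v = Some m"
  shows "contract l r (unravel G n) (occs n) v = tsubst (unravel H (b m)) (track_subst G tr)"
proof
  let ?E = "contract l r (unravel G n) (occs n)"
  let ?\<sigma> = "track_subst G tr"
  fix w show "?E v w = tsubst (unravel H (b m)) ?\<sigma> w"
    using assms(2)
  proof (induction w arbitrary: v m rule: length_induct)
    case (1 w)
    have dom: "occs n \<subseteq> dom (unravel G n)" using redex_occs_dom[OF redex_occs_unravel] .
    have bottom: "?E (v @ [j]) = bottom_term" if "node_at G n (v @ [j]) = None" for j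
    proof (rule contract_bottom[OF _ dom])
      fix u
      have "node_at G n ((v @ [j]) @ u) = None" using that by (subst node_at_append) simp
      then show "unravel G n ((v @ [j]) @ u) = None" by (simp add: unravel_eq)
    qed
    have m: "m \<in> nodes G" using 1(2) by (rule node_at_nodes)
    then have bm: "b m \<in> nodes H" using b nodes_D by (auto simp: graph_morphism_def)
    consider (redex) "m = q" | (var) "m \<in> var_nodes G" | (other) "m \<noteq> q" "m \<notin> var_nodes G" by blast
    then show ?case
    proof cases
      case redex
      then have v: "v \<in> occs n" using 1(2) by (simp add: occs_def)
      have "tsubst r (\<lambda>x. ?E (v @ var_occ l x)) w = tsubst r (\<lambda>x. tsubst (unravel H (b (g x))) ?\<sigma>) w"
      proof (rule tsubst_rhs_cong)
        fix x :: 'l and u :: "nat list" assume x: "x \<in> term_vars r" and u: "length u < length w"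
        have "node_at L \<rho> (var_occ l x) = Some x" using x vars var_occ l_varD by blast
        then show "?E (v @ var_occ l x) u = tsubst (unravel H (b (g x))) ?\<sigma> u"
          using 1(1) u node_at_below_redex[OF v] by blast
      qed
      then show ?thesis using redex v by (simp only: contract_redex[OF v] unravel_H_redex)
    next
      case var
      then have v: "v \<notin> occs n" using 1(2) q_labelled by (auto simp: occs_def)
      have lab: "glab G m = None" "gsucc G m = None"
        using var gsucc_None_iff[OF G] by (simp_all add: var_nodes_def)
      have "?E v w = var_term m w"
      proof (cases w)
        case Nil
        then show ?thesis using v 1(2) lab by (simp add: contract_Nil unravel_eq var_term_def)
      next
        case (Cons j u)
        have "node_at G n (v @ [j]) = None" using 1(2) lab by (simp add: node_at_append)
        then show ?thesis using Cons v bottom by (simp add: contract_Cons bottom_term_def var_term_def)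
      qed
      \<comment> \<open>\<open>b m\<close> stays a variable node, which \<open>track_subst\<close>
        renames back to \<open>m\<close>.\<close>
      moreover have "unravel H (b m) = var_term (b m)"
        using bm track_var_nodes(2)[OF var] gsucc_None_iff[OF H] by (intro unravel_var_node) auto
      ultimately show ?thesis using track_subst_b[OF var tr] by (simp add: tsubst_var)
    next
      case other
      then have v: "v \<notin> occs n" using 1(2) by (auto simp: occs_def)
      obtain f where f: "glab G m = Some f" using other m by (auto simp: var_nodes_def)
      obtain ss where ss: "gsucc G m = Some ss" using f gsucc_None_iff[OF G, of m] by auto
      \<comment> \<open>\<open>D\<close> differs from \<open>G\<close> only at \<open>q\<close>, so
        \<open>b\<close> carries label and successors of \<open>m\<close> to
        \<open>H\<close>.\<close>
      have H_m: "glab H (b m) = Some f" "gsucc H (b m) = Some (map b ss)"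
        using b m f ss other nodes_D by (auto simp: graph_morphism_def D_eq unlabel_def)
      then have root: "unravel H (b m) [] = Some (Inl f)" using bm by (simp add: unravel_eq)
      show ?thesis
      proof (cases w)
        case Nil
        then show ?thesis using v 1(2) f root by (simp add: contract_Nil unravel_eq[of G])
      next
        case (Cons j u)
        show ?thesis
        proof (cases "0 < j \<and> j \<le> length ss")
          case True
          then have s: "ss ! (j - 1) \<in> nodes G" "map b ss ! (j - 1) = b (ss ! (j - 1))"
            using gsucc_nth[OF G ss] by auto
          then have "node_at G n (v @ [j]) = Some (ss ! (j - 1))"
            using 1(2) m ss True by (simp add: node_at_append)
          then have "?E (v @ [j]) u = tsubst (unravel H (b (ss ! (j - 1)))) ?\<sigma> u"
            using 1(1) Cons by simp
          then show ?thesis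
            using Cons v root True s subterm_at_unravel_succ[OF bm H_m(2), of j]
            by (simp add: contract_Cons)
        next
          case False
          then have "node_at G n (v @ [j]) = None" using 1(2) m ss by (auto simp: node_at_append)
          moreover have "subterm_at (unravel H (b m)) [j] = bottom_term"
            unfolding subterm_at_unravel_succ[OF bm H_m(2)] using False by auto
          ultimately show ?thesis using Cons v root bottom by (simp add: contract_Cons tsubst_bottom)
        qed
      qed
    qed
  qed
qed

end

theorem theorem20:
  fixes ar :: "'f \<Rightarrow> nat"
    and p :: "('l, 'r, 'f) eval_rule"
    and G D :: "('n, 'f) tgraph" and H :: "('m, 'f) tgraph"
    and g k :: "'l \<Rightarrow> 'n" and h :: "'r \<Rightarrow> 'm" and d :: "'n \<Rightarrow> 'n" and b tr :: "'n \<Rightarrow> 'm"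
    and n :: 'n
  assumes "evaluation_rule ar p"
    and "non_self_overlapping ar p"
    and "term_graph ar G"
    and "graph_morphism (lhs p) G g"
    and "D = unlabel G (g (rule_root p))"
    and "\<forall>x\<in>nodes D. d x = x"
    and "direct_derivation ar p G D H g k h d b"
    and "\<forall>x\<in>nodes G. tr x = b x"
    and "n \<in> nodes G"
  shows "par_red ar (var_nodes G)
           (unravel G n)
           {(path_occ \<pi>, unravel_rule p) | \<pi>. is_path G n \<pi> (g (rule_root p))}
           (tsubst (unravel H (tr n)) (track_subst G tr))"
proof -
  interpret evaluation_step ar p G D H g k h d b
    using assms by unfold_locales
  have "{(path_occ \<pi>, unravel_rule p) | \<pi>. is_path G n \<pi> q} = (\<lambda>w. (w, (l, r))) ` occs n"
    unfolding occs_def node_at_iff_path by auto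
  moreover have "contract l r (unravel G n) (occs n) [] =
      tsubst (unravel H (tr n)) (track_subst G tr)"
    using contract_unravel[OF assms(8), of n "[]"] assms(8,9) by simp
  \<comment> \<open>Bounded branching leaves only finitely many redexes above any depth, however
    many there are in total.\<close>
  moreover have "finite {w \<in> occs n. length w < i}" for i
    by (rule finite_subset[OF _ finite_occs_length[OF G, of n i]]) (auto simp: occs_def)
  ultimately show ?thesis
    using par_red_contract[OF redex_occs_unravel, of n] by simp
qed

end
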